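(* Let $\omega\in\mathbb R$ and let $f:\mathbb R\to\mathbb R$ satisfy (h1)--(h4) below, with asymptotic slope $l$. Let $L=-\Delta-\omega$ on $\ell^2(\mathbb Z^2)$, so that $\sigma(L)=[-\omega,8-\omega]$, and assume that $0\notin\sigma(L)$ and $l\notin\sigma(L)$; if $\omega<0$, assume also that $l>-\omega$. For all integers $k_1,k_2>1$ let $u^{(k_1,k_2)}\in X_{k_1,k_2}$ be a $(k_1,k_2)$-periodic ground state solution of $$-\Delta u_{n,m}-\omega u_{n,m}=f(u_{n,m}),\qquad (n,m)\in\mathbb Z^2.$$ Then there exist a ground state solution $u\in\ell^2(\mathbb Z^2)$ of this equation and lattice translations $(b,c)=(b_{k_1,k_2},c_{k_1,k_2})\in\mathbb Z^2$ such that $$u^{(k_1,k_2)}(\cdot+b_{k_1,k_2},\cdot+c_{k_1,k_2})\longrightarrow u\quad\text{strongly in }\ell^2(\mathbb Z^2)\text{ as }k_1,k_2\to\infty,$$ where the translated periodic sequence is identified with its restriction to the periodicity cell $Q_{k_1,k_2}$ extended by zero to $\mathbb Z^2$.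
   Context: Discrete Laplacian: $(\Delta u)_{n,m}=u_{n+1,m}+u_{n-1,m}+u_{n,m+1}+u_{n,m-1}-4u_{n,m}$. $\ell^2(\mathbb Z^2)$ is the real Hilbert space of square-summable real sequences with inner product $(u,v)=\sum_{(n,m)\in\mathbb Z^2}u_{n,m}v_{n,m}$. Assumptions on $f$, with $F(t)=\int_0^t f(s)\,ds$: (h1) $f(t)=o(t)$ as $t\to0$; (h2) $\lim_{t\to\pm\infty} f(t)/t=l<\infty$ (the same finite limit $l$ at both ends); (h3) $f\in C^1(\mathbb R)$ and $f(t)t<f'(t)t^2$ for all $t\ne0$; (h4) $\frac12 f(t)t-F(t)\to\infty$ as $t\to\pm\infty$. Periodic setting: $Q_{k_1,k_2}=\{(n,m)\in\mathbb Z^2: -[k_1/2]\le n\le k_1-[k_1/2]-1,\ -[k_2/2]\le m\le k_2-[k_2/2]-1\}$, where $[\cdot]$ is the integer part. $X_{k_1,k_2}$ is the space of real sequences on $\mathbb Z^2$ that are $k_1$-periodic in $n$ and $k_2$-periodic in $m$, with inner product $(u,v)_{k_1,k_2}=\sum_{(n,m)\in Q_{k_1,k_2}}u_{n,m}v_{n,m}$. The formula $L=-\Delta-\omega$ is also used for the operator on $X_{k_1,k_2}$. Put $$J_{k_1,k_2}(u)=\tfrac12(Lu,u)_{k_1,k_2}-\sum_{(n,m)\in Q_{k_1,k_2}}F(u_{n,m}),\qquad J(u)=\tfrac12(Lu,u)-\sum_{(n,m)\in\mathbb Z^2}F(u_{n,m}),$$ on $X_{k_1,k_2}$ and $\ell^2(\mathbb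 Z^2)$ respectively, and $$\mathcal N_{k_1,k_2}=\{u\in X_{k_1,k_2}\setminus\{0\}:\langle J_{k_1,k_2}'(u),u\rangle=0\},\qquad \mathcal N=\{u\in \ell^2(\mathbb Z^2)\setminus\{0\}:\langle J'(u),u\rangle=0\}.$$ A $(k_1,k_2)$-periodic ground state is a minimizer of $J_{k_1,k_2}$ on $\mathcal N_{k_1,k_2}$, and a ground state in $\ell^2(\mathbb Z^2)$ is a minimizer of $J$ on $\mathcal N$; a ground state solution is a ground state that solves the equation.
   Formalization: Convergence is along subsequences: with translations fixed for all periods, every sequence k1,k2→∞ has a subsequence converging strongly to a ground state solution u, which may depend on it. One limit for the whole family fails: for odd f, signs alternating with k1 give a counterexample. *)

theory Defs
  imports "HOL-Analysis.Analysis" "HOL-Library.Landau_Symbols"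
begin

type_synonym lattice_fun = "int \<times> int \<Rightarrow> real"

definition laplacian :: "lattice_fun \<Rightarrow> lattice_fun" where
  "laplacian u = (\<lambda>(n, m). u (n + 1, m) + u (n - 1, m) + u (n, m + 1) + u (n, m - 1) - 4 * u (n, m))"

definition L_op :: "real \<Rightarrow> lattice_fun \<Rightarrow> lattice_fun" where
  "L_op \<omega> u = (\<lambda>p. - laplacian u p - \<omega> * u p)"

definition solves_eq :: "real \<Rightarrow> (real \<Rightarrow> real) \<Rightarrow> lattice_fun \<Rightarrow> bool" where
  "solves_eq \<omega> f u \<longleftrightarrow> (\<forall>p. - laplacian u p - \<omega> * u p = f (u p))"

definition ell2 :: "lattice_fun set" where
  "ell2 = {u. (\<lambda>p. (u p)\<^sup>2) summable_on UNIV}"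

definition ell2_inner :: "lattice_fun \<Rightarrow> lattice_fun \<Rightarrow> real" where
  "ell2_inner u v = (\<Sum>\<^sub>\<infinity>p. u p * v p)"

definition per_cell :: "int \<Rightarrow> int \<Rightarrow> (int \<times> int) set" where
  "per_cell k1 k2 = {- (k1 div 2)..k1 - k1 div 2 - 1} \<times> {- (k2 div 2)..k2 - k2 div 2 - 1}"

definition per_space :: "int \<Rightarrow> int \<Rightarrow> lattice_fun set" where
  "per_space k1 k2 = {u. \<forall>n m. u (n + k1, m) = u (n, m) \<and> u (n, m + k2) = u (n, m)}"

definition per_inner :: "int \<Rightarrow> int \<Rightarrow> lattice_fun \<Rightarrow> lattice_fun \<Rightarrow> real" where
  "per_inner k1 k2 u v = (\<Sum>p\<in>per_cell k1 k2. u p * v p)"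

definition norm_of :: "(lattice_fun \<Rightarrow> lattice_fun \<Rightarrow> real) \<Rightarrow> lattice_fun \<Rightarrow> real" where
  "norm_of ip u = sqrt (ip u u)"

(* Spectrum in the real Hilbert space ell2: the real numbers c for which T - c is not a bijection
   of ell2 with bounded inverse.  For the self-adjoint operator L_op nothing is lost by looking at
   real c only. *)
definition ell2_spectrum :: "(lattice_fun \<Rightarrow> lattice_fun) \<Rightarrow> real set" where
  "ell2_spectrum T = {c. \<not> (bij_betw (\<lambda>u p. T u p - c * u p) ell2 ell2 \<and>
     (\<exists>C. \<forall>u\<in>ell2. norm_of ell2_inner u \<le> C * norm_of ell2_inner (\<lambda>p. T u p - c * u p)))}"

(* D is the Frechet derivative at u of the functional J on the Hilbert space with carrier V and
   inner product ip.  A carrier set is used because the spaces of periodic sequences depend on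
   the integers k1, k2 and so are not types. *)
definition frechet_derivative_on ::
  "lattice_fun set \<Rightarrow> (lattice_fun \<Rightarrow> lattice_fun \<Rightarrow> real) \<Rightarrow> (lattice_fun \<Rightarrow> real) \<Rightarrow>
   lattice_fun \<Rightarrow> (lattice_fun \<Rightarrow> real) \<Rightarrow> bool" where
  "frechet_derivative_on V ip J u D \<longleftrightarrow>
     (\<forall>v\<in>V. \<forall>w\<in>V. D (\<lambda>p. v p + w p) = D v + D w) \<and>
     (\<forall>a. \<forall>v\<in>V. D (\<lambda>p. a * v p) = a * D v) \<and>
     (\<exists>C. \<forall>v\<in>V. \<bar>D v\<bar> \<le> C * norm_of ip v) \<and>
     (\<forall>\<epsilon>>0. \<exists>\<delta>>0. \<forall>h\<in>V. norm_of ip h < \<delta> \<longrightarrow>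
        \<bar>J (\<lambda>p. u p + h p) - J u - D h\<bar> \<le> \<epsilon> * norm_of ip h)"

definition nehari ::
  "lattice_fun set \<Rightarrow> (lattice_fun \<Rightarrow> lattice_fun \<Rightarrow> real) \<Rightarrow> (lattice_fun \<Rightarrow> real) \<Rightarrow> lattice_fun set" where
  "nehari V ip J = {u \<in> V. u \<noteq> (\<lambda>p. 0) \<and> (\<exists>D. frechet_derivative_on V ip J u D \<and> D u = 0)}"

(* The interval integral is oriented, so this is also the intended primitive for t < 0. *)
definition primitive :: "(real \<Rightarrow> real) \<Rightarrow> real \<Rightarrow> real" where
  "primitive f t = (LBINT s=ereal 0..ereal t. f s)"

definition J_per :: "real \<Rightarrow> (real \<Rightarrow> real) \<Rightarrow> int \<Rightarrow> int \<Rightarrow> lattice_fun \<Rightarrow> real" where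
  "J_per \<omega> f k1 k2 u =
     1 / 2 * per_inner k1 k2 (L_op \<omega> u) u - (\<Sum>p\<in>per_cell k1 k2. primitive f (u p))"

definition J_ell2 :: "real \<Rightarrow> (real \<Rightarrow> real) \<Rightarrow> lattice_fun \<Rightarrow> real" where
  "J_ell2 \<omega> f u = 1 / 2 * ell2_inner (L_op \<omega> u) u - (\<Sum>\<^sub>\<infinity>p. primitive f (u p))"

definition nehari_per :: "real \<Rightarrow> (real \<Rightarrow> real) \<Rightarrow> int \<Rightarrow> int \<Rightarrow> lattice_fun set" where
  "nehari_per \<omega> f k1 k2 = nehari (per_space k1 k2) (per_inner k1 k2) (J_per \<omega> f k1 k2)"

definition nehari_ell2 :: "real \<Rightarrow> (real \<Rightarrow> real) \<Rightarrow> lattice_fun set" where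
  "nehari_ell2 \<omega> f = nehari ell2 ell2_inner (J_ell2 \<omega> f)"

definition minimizer_on :: "lattice_fun set \<Rightarrow> (lattice_fun \<Rightarrow> real) \<Rightarrow> lattice_fun \<Rightarrow> bool" where
  "minimizer_on N J u \<longleftrightarrow> u \<in> N \<and> (\<forall>v\<in>N. J u \<le> J v)"

definition per_ground_state_solution ::
  "real \<Rightarrow> (real \<Rightarrow> real) \<Rightarrow> int \<Rightarrow> int \<Rightarrow> lattice_fun \<Rightarrow> bool" where
  "per_ground_state_solution \<omega> f k1 k2 u \<longleftrightarrow>
     minimizer_on (nehari_per \<omega> f k1 k2) (J_per \<omega> f k1 k2) u \<and> solves_eq \<omega> f u"

definition ground_state_solution :: "real \<Rightarrow> (real \<Rightarrow> real) \<Rightarrow> lattice_fun \<Rightarrow> bool" where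
  "ground_state_solution \<omega> f u \<longleftrightarrow>
     minimizer_on (nehari_ell2 \<omega> f) (J_ell2 \<omega> f) u \<and> solves_eq \<omega> f u"

definition translate :: "int \<Rightarrow> int \<Rightarrow> lattice_fun \<Rightarrow> lattice_fun" where
  "translate b c u = (\<lambda>(n, m). u (n + b, m + c))"

definition cut_to_cell :: "int \<Rightarrow> int \<Rightarrow> lattice_fun \<Rightarrow> lattice_fun" where
  "cut_to_cell k1 k2 u = (\<lambda>p. if p \<in> per_cell k1 k2 then u p else 0)"

definition h1 :: "(real \<Rightarrow> real) \<Rightarrow> bool" where
  "h1 f \<longleftrightarrow> f \<in> o[at 0](\<lambda>t. t)"

definition h2 :: "(real \<Rightarrow> real) \<Rightarrow> real \<Rightarrow> bool" where
  "h2 f l \<longleftrightarrow> ((\<lambda>t. f t / t) \<longlongrightarrow> l) at_top \<and> ((\<lambda>t. f t / t) \<longlongrightarrow> l) at_bot"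

definition h3 :: "(real \<Rightarrow> real) \<Rightarrow> bool" where
  "h3 f \<longleftrightarrow> (\<forall>t. f differentiable at t) \<and> continuous_on UNIV (deriv f) \<and>
     (\<forall>t. t \<noteq> 0 \<longrightarrow> f t * t < deriv f t * t\<^sup>2)"

definition h4 :: "(real \<Rightarrow> real) \<Rightarrow> bool" where
  "h4 f \<longleftrightarrow> filterlim (\<lambda>t. 1 / 2 * f t * t - primitive f t) at_top at_top \<and>
     filterlim (\<lambda>t. 1 / 2 * f t * t - primitive f t) at_top at_bot"

(* Convergence of the translated family U to ground state solutions as k1, k2 tend to infinity, in
   the usual variational sense: the translations b, c are chosen once for the whole family, and
   along every sequence of periods tending to infinity some subsequence converges strongly to a
   ground state solution.  The whole family cannot be required to converge to one limit: if f is
   odd then so is the problem, and a family of periodic ground states whose signs alternate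
   with k1 has no such limit. *)
definition converges_to_ground_states ::
  "real \<Rightarrow> (real \<Rightarrow> real) \<Rightarrow> (int \<Rightarrow> int \<Rightarrow> lattice_fun) \<Rightarrow>
   (int \<Rightarrow> int \<Rightarrow> int) \<Rightarrow> (int \<Rightarrow> int \<Rightarrow> int) \<Rightarrow> bool" where
  "converges_to_ground_states \<omega> f U b c \<longleftrightarrow>
     (\<forall>K1 K2 :: nat \<Rightarrow> int.
        filterlim K1 at_top sequentially \<longrightarrow> filterlim K2 at_top sequentially \<longrightarrow>
        (\<exists>u r. ground_state_solution \<omega> f u \<and> strict_mono (r :: nat \<Rightarrow> nat) \<and>
           (\<lambda>j. norm_of ell2_inner (\<lambda>p.
                  cut_to_cell (K1 (r j)) (K2 (r j))
                    (translate (b (K1 (r j)) (K2 (r j))) (c (K1 (r j)) (K2 (r j)))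
                      (U (K1 (r j)) (K2 (r j)))) p - u p)) \<longlonglongrightarrow> 0))"

end

(* The condition 0 \<notin> \<sigma>(L) means \<omega> < 0 or \<omega> > 8.  Since f(t) t > 0 for t \<noteq> 0, the Nehari sets are
   empty when L is negative definite, so \<omega> < 0, L \<ge> a := -\<omega> > 0 and l > 8 - \<omega>.  On the Nehari set the
   functional is the sum of G(u), where G(t) = f(t) t / 2 - F(t) is nonnegative, increasing in |t| and
   coercive by (h4).

   Compactness needs no vanishing/nonvanishing dichotomy on the lattice: bounded energy bounds u in sup
   norm through (h4) and bounds the number of sites where |u| > \<delta>, and where |u| \<le> \<delta> the nonlinear term
   is absorbed by a/2 u^2; this bounds the norm and also forces a site with |u| > \<delta>.  Translating this
   site to 0 gives a nonzero pointwise limit u, which solves the equation and has energy at most the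
   lower limit of the periodic levels, by Fatou.  Conversely, a Nehari point v of the infinite lattice,
   dilated by t > 1 slightly and cut off to a finite set, lies strictly beyond the Nehari set, so
   shrinking its periodic extension back to the Nehari set bounds the periodic levels by
   the sum of G(t v), which tends to J(v) as t tends to 1.  Hence u is a ground state and no energy escapes to
   infinity; far out |u| \<le> \<delta>, and there the density |grad u|^2 + a u^2 - f(u) u, whose total sum is 0,
   dominates a/2 u^2.  This gives strong convergence. *)

theory Submission
  imports Defs
begin

section \<open>The nonlinearity\<close>

text \<open>Three obstacles shape the proof. No Nehari point of the infinite lattice is available in
  advance, so the comparison of levels cannot give the first energy bound. A bump on a single site
  gives it; the quadratic form of a unit bump is \<open>4 - \<omega>\<close>, which is the origin of
  the condition \<open>4 - \<omega> < l\<close>. Cutting off a Nehari point moves it off the Nehari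
  set in an uncontrolled direction. The dilation comes first because the quadratic form scales
  exactly like t^2 while the nonlinear term grows strictly faster; this opens a fixed gap, and the
  cutoff then only has to cost less than the gap. Cutting a periodic solution to its cell could
  create boundary terms in the gradient. The density is therefore taken with the periodic
  neighbours, where its sum over the cell is exactly 0, and the cut enters only in the last
  elementary estimate. That no energy escapes is used in one form: outside a fixed finite set, a
  site with a value above \<delta> would cost a fixed amount of energy that is not left
  over.\<close>

definition energy_density :: "(real \<Rightarrow> real) \<Rightarrow> real \<Rightarrow> real" where
  "energy_density f t = 1 / 2 * f t * t - primitive f t"

locale nonlinearity =
  fixes f :: "real \<Rightarrow> real" and l :: real
  assumes h1: "h1 f" and h2: "h2 f l" and h3: "h3 f" and h4: "h4 f"
begin

abbreviation G :: "real \<Rightarrow> real" where "G \<equiv> energy_density f"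

lemma DERIV_f: "DERIV f t :> deriv f t"
  using h3 by (simp add: h3_def DERIV_deriv_iff_real_differentiable)

lemma DERIV_f_chain [derivative_intros]:
  "DERIV g x :> g' \<Longrightarrow> DERIV (\<lambda>x. f (g x)) x :> deriv f (g x) * g'"
  by (rule DERIV_chain2[OF DERIV_f])

lemma continuous_on_f: "continuous_on A f"
  by (meson DERIV_f DERIV_isCont continuous_at_imp_continuous_on)

lemma tendsto_f: "(g \<longlongrightarrow> x) F \<Longrightarrow> ((\<lambda>j. f (g j)) \<longlongrightarrow> f x) F"
  by (rule isCont_tendsto_compose[OF DERIV_isCont[OF DERIV_f]])

lemma slope_tendsto_0: "((\<lambda>t. f t / t) \<longlongrightarrow> 0) (at 0)"
  using h1 unfolding h1_def by (rule smalloD_tendsto)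

text \<open>The filter \<open>at 0\<close> is punctured, so (h1) determines only the limit of
  \<open>f\<close> at 0; continuity carries it over to the value.\<close>

lemma f_0 [simp]: "f 0 = 0"
proof -
  have "((\<lambda>t. f t / t * t) \<longlongrightarrow> 0 * 0) (at 0)"
    by (intro tendsto_mult slope_tendsto_0 tendsto_ident_at)
  moreover have "eventually (\<lambda>t. f t / t * t = f t) (at 0)"
    by (auto simp: eventually_at_filter)
  ultimately have "(f \<longlongrightarrow> 0) (at 0)"
    by (simp add: filterlim_cong)
  moreover have "(f \<longlongrightarrow> f 0) (at 0)"
    using DERIV_isCont[OF DERIV_f] by (simp add: isCont_def)
  ultimately show ?thesis using LIM_unique by blast
qed

text \<open>(h3) says that the derivative of \<open>f t / t\<close> is positive along rays from the
  origin. Working with the scale \<open>s\<close> on the ray through \<open>t\<close> treats both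
  signs of \<open>t\<close> at once.\<close>

lemma slope_strict_mono:
  assumes "t \<noteq> 0" "0 < r" "r < s"
  shows "f (r * t) / (r * t) < f (s * t) / (s * t)"
proof (rule DERIV_pos_imp_increasing[where f = "\<lambda>s. f (s * t) / (s * t)", OF \<open>r < s\<close>])
  fix x assume x: "r \<le> x" "x \<le> s"
  then have nz: "x * t \<noteq> 0" and x0: "x > 0" using assms by auto
  have "DERIV (\<lambda>s. f (s * t) / (s * t)) x :>
     (deriv f (x * t) * (1 * t) * (x * t) - f (x * t) * (1 * t)) / (x * t)^2"
    using nz by (auto intro!: derivative_eq_intros simp: power2_eq_square)
  moreover have "(deriv f (x * t) * (1 * t) * (x * t) - f (x * t) * (1 * t)) / (x * t)^2 =
     (deriv f (x * t) * (x * t)^2 - f (x * t) * (x * t)) / (x * (x * t)^2)"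
    using nz x0 by (simp add: field_simps power2_eq_square)
  moreover have "\<dots> > 0"
    using h3 nz x0 by (auto simp: h3_def intro!: divide_pos_pos mult_pos_pos)
  ultimately show "\<exists>y. DERIV (\<lambda>s. f (s * t) / (s * t)) x :> y \<and> 0 < y"
    by metis
qed

lemma f_mult_strict_mono:
  assumes "t \<noteq> 0" "1 < s"
  shows "s\<^sup>2 * (f t * t) < f (s * t) * (s * t)"
proof -
  have "f (1 * t) / (1 * t) * (s * t)^2 < f (s * t) / (s * t) * (s * t)^2"
    using slope_strict_mono[OF assms(1) _ assms(2)] assms by (intro mult_strict_right_mono) auto
  then show ?thesis using assms by (simp add: field_simps power2_eq_square)
qed

lemma f_mult_pos:
  assumes "t \<noteq> 0" shows "0 < f t * t"
proof -
  have lim: "((\<lambda>s. f (s * t) / (s * t)) \<longlongrightarrow> 0) (at_right 0)"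
  proof (rule filterlim_compose[OF slope_tendsto_0])
    show "filterlim (\<lambda>s. s * t) (at 0) (at_right 0)"
      unfolding filterlim_at using assms
      by (auto simp: eventually_at_filter intro!: tendsto_eq_intros)
  qed
  \<comment> \<open>A limit yields only a weak inequality, so it is taken at scale 1/2; strictness
    returns on the way from 1/2 to 1.\<close>
  have "0 \<le> f (1/2 * t) / (1/2 * t)"
  proof (rule tendsto_upperbound[OF lim])
    have "eventually (\<lambda>s. s \<in> {0<..<1/2}) (at_right (0::real))"
      by (rule eventually_at_right_real) simp
    then show "eventually (\<lambda>s. f (s * t) / (s * t) \<le> f (1/2 * t) / (1/2 * t)) (at_right 0)"
    proof eventually_elim
      fix s :: real assume "s \<in> {0<..<1/2}"
      then show "f (s * t) / (s * t) \<le> f (1/2 * t) / (1/2 * t)"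
        using slope_strict_mono[OF assms, of s "1/2"] by (intro less_imp_le) (auto simp del: divide_divide_eq_left mult_eq_0_iff)
    qed
  qed simp
  also have "\<dots> < f (1 * t) / (1 * t)"
    by (rule slope_strict_mono[OF assms]) auto
  finally show ?thesis using assms by (simp add: zero_less_divide_iff zero_less_mult_iff)
qed

lemma f_mult_nonneg: "0 \<le> f t * t"
  using f_mult_pos[of t] by (cases "t = 0") auto

text \<open>The slope increases along each ray and so stays below its limit \<open>l\<close>; for
  negative \<open>t\<close> the ray runs to minus infinity.\<close>

lemma f_mult_le: "f t * t \<le> l * t\<^sup>2"
proof (cases "t = 0")
  case False
  have lim: "((\<lambda>s. f (s * t) / (s * t)) \<longlongrightarrow> l) at_top"
  proof (cases "t > 0")
    case True
    then have "filterlim (\<lambda>s. s * t) at_top at_top"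
      by (intro filterlim_at_top_mult_tendsto_pos[where c = t]) (auto simp: filterlim_ident)
    then show ?thesis
      using h2 unfolding h2_def by (auto intro: filterlim_compose[of "\<lambda>t. f t / t"])
  next
    case False
    with \<open>t \<noteq> 0\<close> have "t < 0" by simp
    then have "filterlim (\<lambda>s. s * (-t)) at_top at_top"
      by (intro filterlim_at_top_mult_tendsto_pos[where c = "-t"]) (auto simp: filterlim_ident)
    then have "filterlim (\<lambda>s. s * t) at_bot at_top"
      by (subst filterlim_uminus_at_bot) simp
    then show ?thesis
      using h2 unfolding h2_def by (auto intro: filterlim_compose[of "\<lambda>t. f t / t"])
  qed
  have "f (1 * t) / (1 * t) \<le> l"
  proof (rule tendsto_lowerbound[OF lim])
    show "eventually (\<lambda>s. f (1 * t) / (1 * t) \<le> f (s * t) / (s * t)) at_top"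
      using eventually_gt_at_top[of "1::real"]
    proof eventually_elim
      fix s :: real assume "1 < s"
      then show "f (1 * t) / (1 * t) \<le> f (s * t) / (s * t)"
        using slope_strict_mono[OF False, of 1 s] by (intro less_imp_le) auto
    qed
  qed simp
  then have "f t / t * t^2 \<le> l * t^2" by (intro mult_right_mono) auto
  then show ?thesis using False by (simp add: power2_eq_square)
qed simp

lemma l_pos: "0 < l"
  using f_mult_pos[of 1] f_mult_le[of 1] by simp

text \<open>Used with \<open>a = - \<omega>\<close>, the lower bound of the quadratic form: up to
  the threshold \<open>\<delta>\<close> the nonlinear term uses up at most half of it.\<close>

lemma f_mult_small:
  assumes "a > 0"
  obtains \<delta> where "\<delta> > 0" "\<And>t. \<bar>t\<bar> \<le> \<delta> \<Longrightarrow> f t * t \<le> a / 2 * t\<^sup>2"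
proof -
  have "eventually (\<lambda>t. f t / t < a / 2) (at 0)"
    using slope_tendsto_0 assms by (intro order_tendstoD(2)) auto
  then obtain d where d: "d > 0" "\<And>t. t \<noteq> 0 \<Longrightarrow> \<bar>t\<bar> < d \<Longrightarrow> f t / t < a / 2"
    unfolding eventually_at by (auto simp: dist_real_def)
  show ?thesis
  proof
    show "d / 2 > 0" using d by simp
    fix t :: real assume t: "\<bar>t\<bar> \<le> d / 2"
    show "f t * t \<le> a / 2 * t\<^sup>2"
    proof (cases "t = 0")
      case False
      then have "f t / t < a / 2" using t d by auto
      then have "f t / t * t^2 \<le> a / 2 * t^2" by (intro mult_right_mono) auto
      then show ?thesis using False by (simp add: power2_eq_square)
    qed simp
  qed
qed

section \<open>The primitive F and the energy density G\<close>

lemma DERIV_primitive: "DERIV (primitive f) t :> f t"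
proof -
  \<comment> \<open>\<open>t\<close> must be interior to the interval, so that the derivative within
    it is the full derivative.\<close>
  define R where "R = \<bar>t\<bar> + 1"
  have "((\<lambda>u. LBINT y=ereal 0..ereal u. f y) has_vector_derivative f t) (at t within {-R..R})"
    by (rule interval_integral_FTC2) (auto simp: R_def intro: continuous_on_f)
  moreover have "at t within {-R..R} = at t"
    by (rule at_within_interior) (auto simp: R_def)
  ultimately show ?thesis
    by (simp add: primitive_def[abs_def] has_real_derivative_iff_has_vector_derivative)
qed

lemma DERIV_primitive_chain [derivative_intros]:
  "DERIV g x :> g' \<Longrightarrow> DERIV (\<lambda>x. primitive f (g x)) x :> f (g x) * g'"
  by (rule DERIV_chain2[OF DERIV_primitive])

lemma primitive_0 [simp]: "primitive f 0 = 0"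
  by (simp add: primitive_def zero_ereal_def[symmetric])

lemma continuous_on_primitive: "continuous_on A (primitive f)"
  by (meson DERIV_primitive DERIV_isCont continuous_at_imp_continuous_on)

lemma primitive_nonneg: "0 \<le> primitive f t"
proof -
  have "primitive f (0 * t) \<le> primitive f (1 * t)"
  proof (rule DERIV_nonneg_imp_nondecreasing[where f = "\<lambda>s. primitive f (s * t)"])
    fix x :: real assume x: "0 \<le> x" "x \<le> 1"
    have "DERIV (\<lambda>s. primitive f (s * t)) x :> f (x * t) * t"
      by (auto intro!: derivative_eq_intros)
    \<comment> \<open>For \<open>x > 0\<close> this is \<open>f (x * t) * (x * t)\<close> divided by
      \<open>x\<close>; for \<open>x = 0\<close> it is 0.\<close>
    moreover have "f (x * t) * t \<ge> 0"
      using f_mult_nonneg[of "x * t"] x mult_nonneg_nonneg[of "f (x * t) * (x * t)" "1 / x"]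
      by (cases "x = 0") auto
    ultimately show "\<exists>y. DERIV (\<lambda>s. primitive f (s * t)) x :> y \<and> 0 \<le> y" by blast
  qed simp
  then show ?thesis by simp
qed

lemma continuous_on_G: "continuous_on A G"
  unfolding energy_density_def[abs_def]
  by (intro continuous_intros continuous_on_f continuous_on_primitive)

lemma tendsto_G: "(g \<longlongrightarrow> x) F \<Longrightarrow> ((\<lambda>j. G (g j)) \<longlongrightarrow> G x) F"
  using continuous_on_G[of UNIV]
  by (intro isCont_tendsto_compose[of _ G]) (auto simp: continuous_on_eq_continuous_at)

lemma DERIV_G_scale:
  "DERIV (\<lambda>s. G (s * t)) x :> 1 / 2 * (deriv f (x * t) * (x * t) - f (x * t)) * t"
  unfolding energy_density_def
  by (auto intro!: derivative_eq_intros simp: algebra_simps)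

lemma G_0 [simp]: "G 0 = 0"
  by (simp add: energy_density_def)

lemma G_strict_mono:
  assumes "t \<noteq> 0" "0 \<le> r" "r < s"
  shows "G (r * t) < G (s * t)"
\<comment> \<open>The scale \<open>r = 0\<close> is allowed and the derivative vanishes there, so
  positivity is asked only in the open interval.\<close>
proof (rule DERIV_pos_imp_increasing_open[where f = "\<lambda>s. G (s * t)", OF \<open>r < s\<close>])
  fix x assume x: "r < x" "x < s"
  then have nz: "x * t \<noteq> 0" and x0: "x > 0" using assms by auto
  have "1 / 2 * (deriv f (x * t) * (x * t) - f (x * t)) * t =
     (deriv f (x * t) * (x * t)^2 - f (x * t) * (x * t)) / (2 * x)"
    using x0 by (simp add: field_simps power2_eq_square)
  moreover have "\<dots> > 0"
    using h3 nz x0 by (auto simp: h3_def intro!: divide_pos_pos mult_pos_pos)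
  ultimately show "\<exists>y. DERIV (\<lambda>s. G (s * t)) x :> y \<and> 0 < y"
    using DERIV_G_scale by metis
next
  show "continuous_on {r..s} (\<lambda>s. G (s * t))"
    by (intro continuous_on_compose2[OF continuous_on_G[of UNIV]] continuous_intros) auto
qed

lemma G_mono: "0 \<le> r \<Longrightarrow> r \<le> s \<Longrightarrow> G (r * t) \<le> G (s * t)"
  using G_strict_mono[of t r s] by (cases "t = 0"; cases "r = s") auto

lemma G_nonneg: "0 \<le> G t"
  using G_mono[of 0 1 t] by simp

text \<open>Half of \<open>f t * t\<close> is the sum of the nonnegative quantities
  \<open>G t\<close> and \<open>primitive f t\<close>, so each inherits the quadratic bound that
  makes its sum over the lattice converge.\<close>

lemma G_le: "G t \<le> l / 2 * t\<^sup>2"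
  using f_mult_le[of t] primitive_nonneg[of t] by (simp add: energy_density_def)

lemma primitive_le: "primitive f t \<le> l / 2 * t\<^sup>2"
  using f_mult_le[of t] G_nonneg[of t] by (simp add: energy_density_def)

text \<open>\<open>G\<close> increases along both rays, so outside the interval it is at least the
  smaller of its values at \<open>\<delta>\<close> and \<open>- \<delta>\<close>. Every large site
  thus costs a fixed amount of energy.\<close>

lemma G_bounded_below:
  assumes "\<delta> > 0"
  obtains \<eta> where "\<eta> > 0" "\<And>t. \<bar>t\<bar> \<ge> \<delta> \<Longrightarrow> \<eta> \<le> G t"
proof
  have pos: "0 < G t" if "t \<noteq> 0" for t
    using G_strict_mono[OF that, of 0 1] by simp
  show "0 < min (G \<delta>) (G (-\<delta>))" using pos assms by simp
  fix t assume t: "\<bar>t\<bar> \<ge> \<delta>"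
  show "min (G \<delta>) (G (-\<delta>)) \<le> G t"
  proof (cases "t > 0")
    case True
    then show ?thesis using G_mono[of "\<delta>/t" 1 t] t assms by auto
  next
    case False
    then show ?thesis using G_mono[of "\<delta>/(-t)" 1 t] t assms by (auto simp: field_simps)
  qed
qed

lemma G_sublevel_bounded:
  obtains M where "\<And>t. G t \<le> C \<Longrightarrow> \<bar>t\<bar> \<le> M"
proof -
  have "eventually (\<lambda>t. C < G t) at_top" "eventually (\<lambda>t. C < G t) at_bot"
    using h4 unfolding h4_def energy_density_def filterlim_at_top_dense by auto
  then obtain A B where "\<And>t. t \<ge> A \<Longrightarrow> C < G t" "\<And>t. t \<le> B \<Longrightarrow> C < G t"
    unfolding eventually_at_top_linorder eventually_at_bot_linorder by blast
  then have "\<bar>t\<bar> \<le> \<bar>A\<bar> + \<bar>B\<bar>" if "G t \<le> C" for t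
    using that by (smt (verit) abs_ge_self)
  then show ?thesis using that by blast
qed

section \<open>Estimates on bounded ranges of values\<close>

lemma deriv_f_bounded:
  obtains K where "K > 0" "\<And>t. \<bar>t\<bar> \<le> M \<Longrightarrow> \<bar>deriv f t\<bar> \<le> K"
proof -
  have "compact (deriv f ` {-M..M})"
    using h3 by (intro compact_continuous_image) (auto simp: h3_def intro: continuous_on_subset)
  then obtain K where K: "K > 0" "\<And>x. x \<in> deriv f ` {-M..M} \<Longrightarrow> norm x \<le> K"
    using compact_imp_bounded bounded_pos by metis
  show ?thesis by (rule that[OF K(1)]) (use K(2)[OF imageI] in \<open>auto simp: abs_le_iff\<close>)
qed

lemma f_locally_lipschitz:
  obtains K where "K > 0" "\<And>s t. \<bar>s\<bar> \<le> M \<Longrightarrow> \<bar>t\<bar> \<le> M \<Longrightarrow> \<bar>f s - f t\<bar> \<le> K * \<bar>s - t\<bar>"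
proof -
  obtain K where K: "K > 0" "\<And>t. \<bar>t\<bar> \<le> M \<Longrightarrow> \<bar>deriv f t\<bar> \<le> K"
    using deriv_f_bounded by blast
  show ?thesis
  proof (rule that[OF K(1)])
    fix s t assume "\<bar>s\<bar> \<le> M" "\<bar>t\<bar> \<le> M"
    then show "\<bar>f s - f t\<bar> \<le> K * \<bar>s - t\<bar>"
      using field_differentiable_bound[of "{-M..M}" f "deriv f" K s t] K(2)
        DERIV_subset[OF DERIV_f] by (auto simp: abs_le_iff)
  qed
qed

text \<open>The remainder is quadratic in \<open>h\<close> with one constant for the whole range,
  hence summable over the lattice. It is the mean value inequality for
  \<open>primitive f z - f x * z\<close> on the segment from \<open>x\<close> to
  \<open>x + h\<close>.\<close>

lemma primitive_remainder:
  assumes lip: "\<And>s t. \<bar>s\<bar> \<le> M \<Longrightarrow> \<bar>t\<bar> \<le> M \<Longrightarrow> \<bar>f s - f t\<bar> \<le> K * \<bar>s - t\<bar>"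
    and "0 < K" "\<bar>x\<bar> \<le> M" "\<bar>x + h\<bar> \<le> M"
  shows "\<bar>primitive f (x + h) - primitive f x - f x * h\<bar> \<le> K * h\<^sup>2"
proof -
  let ?S = "closed_segment x (x + h)"
  have seg: "\<bar>z\<bar> \<le> M \<and> \<bar>z - x\<bar> \<le> \<bar>h\<bar>" if "z \<in> ?S" for z
    using that assms(3,4) by (auto simp: closed_segment_eq_real_ivl abs_le_iff split: if_splits)
  have "norm ((\<lambda>z. primitive f z - f x * z) (x + h) - (\<lambda>z. primitive f z - f x * z) x)
      \<le> K * \<bar>h\<bar> * norm (x + h - x)"
  proof (rule field_differentiable_bound[where S = ?S and f' = "\<lambda>z. f z - f x"])
    fix z assume z: "z \<in> ?S"
    show "((\<lambda>z. primitive f z - f x * z) has_field_derivative f z - f x) (at z within ?S)"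
      by (auto intro!: derivative_eq_intros DERIV_subset[OF DERIV_primitive])
    have "\<bar>f z - f x\<bar> \<le> K * \<bar>z - x\<bar>"
      using lip[of z x] seg[OF z] assms by auto
    also have "\<dots> \<le> K * \<bar>h\<bar>" using seg[OF z] assms by (intro mult_left_mono) auto
    finally show "norm (f z - f x) \<le> K * \<bar>h\<bar>" by simp
  qed auto
  then show ?thesis by (simp add: algebra_simps power2_eq_square abs_mult_self_eq)
qed

text \<open>The factor \<open>t\<^sup>2\<close> makes the error summable along a square-summable
  sequence, so a slight dilation raises the total energy only slightly.\<close>

lemma G_scale_close:
  obtains K where "K > 0" "\<And>s t. \<bar>t\<bar> \<le> M \<Longrightarrow> 1 \<le> s \<Longrightarrow> s \<le> 2 \<Longrightarrow> G (s * t) \<le> G t + K * (s - 1) * t\<^sup>2"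
proof -
  \<comment> \<open>The derivative is evaluated at \<open>x * t\<close> with
    \<open>x \<le> 2\<close>, hence the range \<open>2 * M\<close>.\<close>
  obtain K where K: "K > 0" "\<And>t. \<bar>t\<bar> \<le> 2 * M \<Longrightarrow> \<bar>deriv f t\<bar> \<le> K"
    using deriv_f_bounded by blast
  show ?thesis
  proof (rule that[OF K(1)])
    fix s t :: real assume *: "\<bar>t\<bar> \<le> M" "1 \<le> s" "s \<le> 2"
    have "norm ((\<lambda>s. G (s * t)) s - (\<lambda>s. G (s * t)) 1) \<le> (K * t\<^sup>2) * norm (s - 1)"
    proof (rule field_differentiable_bound[where S = "{1..2}"])
      fix x :: real assume x: "x \<in> {1..2}"
      show "((\<lambda>s. G (s * t)) has_field_derivative 1 / 2 * (deriv f (x * t) * (x * t) - f (x * t)) * t)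
         (at x within {1..2})"
        by (rule DERIV_subset[OF DERIV_G_scale]) auto
      have "\<bar>x * t\<bar> \<le> 2 * M" using x * by (auto simp: abs_mult intro!: mult_mono)
      then have d: "deriv f (x * t) \<le> K" using K(2) by fastforce
      \<comment> \<open>In this form the subtracted term is nonnegative and may be dropped from
        above, and \<open>x \<le> 2\<close> cancels the factor 1/2.\<close>
      have eq: "1 / 2 * (deriv f (x * t) * (x * t) - f (x * t)) * t =
          1 / 2 * (deriv f (x * t) * x * t^2 - (f (x * t) * (x * t)) / x)"
        using x by (simp add: field_simps power2_eq_square)
      have 1: "deriv f (x * t) * x * t^2 \<le> K * 2 * t^2"
      proof (rule mult_right_mono)
        have "deriv f (x * t) * x \<le> K * x" using x d by (intro mult_right_mono) auto
        also have "\<dots> \<le> K * 2" using x K(1) by (intro mult_left_mono) auto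
        finally show "deriv f (x * t) * x \<le> K * 2" .
      qed simp
      have 2: "0 \<le> f (x * t) * (x * t) / x"
        using f_mult_nonneg[of "x * t"] x by (intro divide_nonneg_nonneg) auto
      have 3: "0 \<le> deriv f (x * t) * x * t^2 - (f (x * t) * (x * t)) / x"
      proof (cases "t = 0")
        case False
        then have "f (x * t) * (x * t) < deriv f (x * t) * (x * t)^2"
          using h3 x by (auto simp: h3_def)
        then have "0 \<le> (deriv f (x * t) * (x * t)^2 - f (x * t) * (x * t)) / x"
          using x by (intro divide_nonneg_nonneg) auto
        also have "\<dots> = deriv f (x * t) * x * t^2 - (f (x * t) * (x * t)) / x"
          using x by (simp add: field_simps power2_eq_square)
        finally show ?thesis .
      qed simp
      show "norm (1 / 2 * (deriv f (x * t) * (x * t) - f (x * t)) * t) \<le> K * t\<^sup>2"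
        unfolding eq using 1 2 3 by simp
    qed (use * in auto)
    then show "G (s * t) \<le> G t + K * (s - 1) * t\<^sup>2"
      using * by (simp add: algebra_simps)
  qed
qed

end

section \<open>Shift-invariant spaces of lattice functions\<close>

lemma summable_on_dominated:
  fixes g h :: "'a \<Rightarrow> real"
  assumes "g summable_on A" "\<And>x. x \<in> A \<Longrightarrow> \<bar>h x\<bar> \<le> g x"
  shows "h summable_on A"
proof -
  have "(\<lambda>x. norm (h x)) summable_on A"
    by (rule Infinite_Sum.abs_summable_on_comparison_test'[OF assms(1)]) (use assms(2) in auto)
  then show ?thesis by (rule iffD2[OF summable_on_iff_abs_summable_on_real])
qed

lemma abs_infsum_le:
  fixes g h :: "'a \<Rightarrow> real"
  assumes "g summable_on A" "\<And>x. x \<in> A \<Longrightarrow> \<bar>h x\<bar> \<le> g x"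
  shows "\<bar>infsum h A\<bar> \<le> infsum g A"
proof -
  have h: "h summable_on A" by (rule summable_on_dominated[OF assms])
  have "infsum h A \<le> infsum g A"
    by (rule infsum_mono[OF h assms(1)]) (use assms(2) in fastforce)
  moreover have "- infsum h A \<le> infsum g A"
    unfolding infsum_uminus[symmetric]
    by (rule infsum_mono[OF _ assms(1)]) (use h assms(2) in \<open>fastforce simp: summable_on_uminus\<close>)+
  ultimately show ?thesis by simp
qed

lemma infsum_diff:
  fixes g h :: "'a \<Rightarrow> real"
  assumes "g summable_on A" "h summable_on A"
  shows "infsum (\<lambda>x. g x - h x) A = infsum g A - infsum h A"
  using infsum_add[of g A "\<lambda>x. - h x"] assms by (simp add: summable_on_uminus infsum_uminus)

lemma summable_on_diff:
  fixes g h :: "'a \<Rightarrow> real"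
  assumes "g summable_on A" "h summable_on A"
  shows "(\<lambda>x. g x - h x) summable_on A"
  using summable_on_add[of g A "\<lambda>x. - h x"] assms by (simp add: summable_on_uminus)

lemma finite_tail_less:
  fixes g :: "'a \<Rightarrow> real"
  assumes "g summable_on A" "\<epsilon> > 0"
  obtains B where "finite B" "B \<subseteq> A"
    "\<And>C. finite C \<Longrightarrow> B \<subseteq> C \<Longrightarrow> C \<subseteq> A \<Longrightarrow> \<bar>infsum g A - sum g C\<bar> < \<epsilon>"
proof -
  have "eventually (\<lambda>C. dist (sum g C) (infsum g A) < \<epsilon>) (finite_subsets_at_top A)"
    using infsum_tendsto[OF assms(1)] assms(2) by (rule tendstoD)
  then show ?thesis
    unfolding eventually_finite_subsets_at_top
    using that by (auto simp: dist_real_def abs_minus_commute)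
qed

text \<open>With the neighbours written as additive shifts, one shift rule of a lattice space serves
  all four of them.\<close>

lemma laplacian_shift:
  "laplacian u p = u (p + (1, 0)) + u (p + (- 1, 0)) + u (p + (0, 1)) + u (p + (0, - 1)) - 4 * u p"
  by (cases p) (simp add: laplacian_def)

text \<open>Forward differences only: each edge of the lattice is counted once.\<close>

definition grad_sq :: "lattice_fun \<Rightarrow> lattice_fun" where
  "grad_sq u p = (u (p + (1, 0)) - u p)\<^sup>2 + (u (p + (0, 1)) - u p)\<^sup>2"

lemma grad_sq_nonneg: "0 \<le> grad_sq u p"
  by (simp add: grad_sq_def)

text \<open>Both \<open>ell2\<close> (with \<open>S = UNIV\<close>) and the periodic spaces (with \<open>S\<close> the periodicity cell)
  are instances, so that the calculus of the two functionals is done only once.\<close>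

locale lattice_space =
  fixes S :: "(int \<times> int) set" and V :: "lattice_fun set"
  assumes add: "u \<in> V \<Longrightarrow> v \<in> V \<Longrightarrow> (\<lambda>p. u p + v p) \<in> V"
    and compose: "u \<in> V \<Longrightarrow> (\<And>t. \<bar>g t\<bar> \<le> c * \<bar>t\<bar>) \<Longrightarrow> (\<lambda>p. g (u p)) \<in> V"
    and shift: "u \<in> V \<Longrightarrow> (\<lambda>p. u (p + e)) \<in> V"
    and square_summable: "u \<in> V \<Longrightarrow> (\<lambda>p. (u p)\<^sup>2) summable_on S"
    and inner_shift: "u \<in> V \<Longrightarrow> v \<in> V \<Longrightarrow>
      (\<Sum>\<^sub>\<infinity>p\<in>S. u (p + e) * v (p + e)) = (\<Sum>\<^sub>\<infinity>p\<in>S. u p * v p)"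
begin

definition ip :: "lattice_fun \<Rightarrow> lattice_fun \<Rightarrow> real" where
  "ip u v = (\<Sum>\<^sub>\<infinity>p\<in>S. u p * v p)"

abbreviation nrm :: "lattice_fun \<Rightarrow> real" where "nrm \<equiv> norm_of ip"

lemma scale: "u \<in> V \<Longrightarrow> (\<lambda>p. c * u p) \<in> V"
  by (rule compose[of u "\<lambda>t. c * t" "\<bar>c\<bar>"]) (simp_all add: abs_mult)

lemma diff: "u \<in> V \<Longrightarrow> v \<in> V \<Longrightarrow> (\<lambda>p. u p - v p) \<in> V"
  using add[of u "\<lambda>p. - 1 * v p"] scale[of v "-1"] by simp

lemma mult_summable:
  assumes "u \<in> V" "v \<in> V"
  shows "(\<lambda>p. u p * v p) summable_on S"
proof (rule summable_on_dominated)
  show "(\<lambda>p. (u p)\<^sup>2 + (v p)\<^sup>2) summable_on S"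
    using assms by (intro summable_on_add square_summable)
  have "\<bar>x * y\<bar> \<le> x\<^sup>2 + y\<^sup>2" for x y :: real
    using sum_squares_bound[of "\<bar>x\<bar>" "\<bar>y\<bar>"] mult_nonneg_nonneg[of "\<bar>x\<bar>" "\<bar>y\<bar>"]
    by (simp add: abs_mult del: mult_nonneg_nonneg zero_le_mult_iff)
  then show "\<bar>u p * v p\<bar> \<le> (u p)\<^sup>2 + (v p)\<^sup>2" for p .
qed

lemma ip_commute: "ip u v = ip v u"
  by (simp add: ip_def mult.commute)

lemma ip_add_left: "u \<in> V \<Longrightarrow> v \<in> V \<Longrightarrow> w \<in> V \<Longrightarrow> ip (\<lambda>p. u p + v p) w = ip u w + ip v w"
  by (simp add: ip_def distrib_right infsum_add mult_summable)

lemma ip_add_right: "u \<in> V \<Longrightarrow> v \<in> V \<Longrightarrow> w \<in> V \<Longrightarrow> ip w (\<lambda>p. u p + v p) = ip w u + ip w v"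
  by (simp add: ip_commute[of w] ip_add_left)

lemma ip_scale_left: "ip (\<lambda>p. c * u p) v = c * ip u v"
  by (simp add: ip_def mult.assoc infsum_cmult_right')

lemma ip_scale_right: "ip v (\<lambda>p. c * u p) = c * ip v u"
  by (simp add: ip_commute[of v] ip_scale_left)

lemma ip_self: "ip u u = (\<Sum>\<^sub>\<infinity>p\<in>S. (u p)\<^sup>2)"
  by (simp add: ip_def power2_eq_square)

lemma ip_self_nonneg: "0 \<le> ip u u"
  unfolding ip_self by (rule infsum_nonneg) simp

lemma nrm_nonneg: "0 \<le> nrm u"
  by (simp add: norm_of_def ip_self_nonneg)

lemma nrm_sq: "(nrm u)\<^sup>2 = ip u u"
  by (simp add: norm_of_def ip_self_nonneg)

lemma nrm_scale: "nrm (\<lambda>p. c * u p) = \<bar>c\<bar> * nrm u"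
  by (simp add: norm_of_def ip_scale_left ip_scale_right real_sqrt_mult flip: mult.assoc)

lemma nrm_shift: "u \<in> V \<Longrightarrow> nrm (\<lambda>p. u (p + e)) = nrm u"
  by (simp add: norm_of_def ip_def inner_shift)

lemma pointwise_le_nrm:
  assumes "u \<in> V" "p \<in> S" shows "\<bar>u p\<bar> \<le> nrm u"
proof -
  have "(\<Sum>p\<in>{p}. (u p)\<^sup>2) \<le> (\<Sum>\<^sub>\<infinity>p\<in>S. (u p)\<^sup>2)"
    by (rule finite_sum_le_infsum) (use assms square_summable in auto)
  then have "\<bar>u p\<bar>\<^sup>2 \<le> (nrm u)\<^sup>2" by (simp add: nrm_sq ip_self)
  then show ?thesis using nrm_nonneg by (rule power2_le_imp_le)
qed

lemma Cauchy_Schwarz: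
  assumes "u \<in> V" "v \<in> V" shows "\<bar>ip u v\<bar> \<le> nrm u * nrm v"
proof (cases "nrm v = 0")
  case True
  \<comment> \<open>\<open>ip\<close> sees only the values on \<open>S\<close>, so a vector of norm
    0 is known to vanish there, which is enough for \<open>ip u v\<close>.\<close>
  have "v p = 0" if "p \<in> S" for p
    using pointwise_le_nrm[OF assms(2) that] True by simp
  then have "ip u v = 0" unfolding ip_def by (intro infsum_0) auto
  then show ?thesis using True by simp
next
  case False
  then have pos: "0 < ip v v" using nrm_sq[of v] ip_self_nonneg[of v] by (metis power2_eq_square mult_eq_0_iff order_le_less)
  \<comment> \<open>The minimizer of the quadratic polynomial that maps t to the squared norm of u +
    t v.\<close>
  define t where "t = - ip u v / ip v v"
  have "0 \<le> ip (\<lambda>p. u p + t * v p) (\<lambda>p. u p + t * v p)" by (rule ip_self_nonneg)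
  also have "\<dots> = ip u u + 2 * t * ip u v + t\<^sup>2 * ip v v"
    using assms by (simp add: ip_add_left ip_add_right ip_scale_left ip_scale_right add scale
        ip_commute[of v u] power2_eq_square algebra_simps)
  also have "\<dots> = ip u u - (ip u v)\<^sup>2 / ip v v"
    using pos by (simp add: t_def field_simps power2_eq_square)
  finally have "(ip u v)\<^sup>2 \<le> ip u u * ip v v" using pos by (simp add: field_simps)
  then have "\<bar>ip u v\<bar>\<^sup>2 \<le> (nrm u * nrm v)\<^sup>2" by (simp add: power_mult_distrib nrm_sq)
  then show ?thesis by (rule power2_le_imp_le) (simp add: nrm_nonneg)
qed

lemma nrm_triangle:
  assumes "u \<in> V" "v \<in> V" shows "nrm (\<lambda>p. u p + v p) \<le> nrm u + nrm v"
proof (rule power2_le_imp_le)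
  have "(nrm (\<lambda>p. u p + v p))\<^sup>2 = ip u u + 2 * ip u v + ip v v"
    using assms by (simp add: nrm_sq ip_add_left ip_add_right add ip_commute[of v u])
  also have "\<dots> \<le> (nrm u + nrm v)\<^sup>2"
    using Cauchy_Schwarz[OF assms] by (simp add: power2_sum nrm_sq)
  finally show "(nrm (\<lambda>p. u p + v p))\<^sup>2 \<le> (nrm u + nrm v)\<^sup>2" .
qed (simp add: nrm_nonneg)

section \<open>The operator and its quadratic form\<close>

lemma L_op_split:
  "L_op \<omega> u = (\<lambda>p. ((- 1 * u (p + (1, 0)) + - 1 * u (p + (- 1, 0))) +
     (- 1 * u (p + (0, 1)) + - 1 * u (p + (0, - 1)))) + (4 - \<omega>) * u p)"
  by (rule ext) (simp add: L_op_def laplacian_shift algebra_simps)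

lemma L_op_closed: "u \<in> V \<Longrightarrow> L_op \<omega> u \<in> V"
  unfolding L_op_split by (intro add scale shift)

lemma L_op_add: "L_op \<omega> (\<lambda>p. u p + v p) = (\<lambda>p. L_op \<omega> u p + L_op \<omega> v p)"
  by (rule ext) (simp add: L_op_def laplacian_shift algebra_simps)

lemma L_op_scale: "L_op \<omega> (\<lambda>p. c * u p) = (\<lambda>p. c * L_op \<omega> u p)"
  by (rule ext) (simp add: L_op_def laplacian_shift algebra_simps)

text \<open>Shifts preserve the norm, so four neighbours and the diagonal term contribute
  \<open>4 + \<bar>4 - \<omega>\<bar>\<close>.\<close>

lemma nrm_L_op_le:
  assumes "u \<in> V" shows "nrm (L_op \<omega> u) \<le> (8 + \<bar>\<omega>\<bar>) * nrm u"
proof -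
  let ?T = "\<lambda>c e p. c * u (p + e)"
  have V: "?T c e \<in> V" for c e using scale[OF shift[OF assms]] .
  have n: "nrm (?T c e) = \<bar>c\<bar> * nrm u" for c e
    using nrm_scale[of c "\<lambda>p. u (p + e)"] nrm_shift[OF assms] by simp
  have tri: "nrm (\<lambda>p. ((a p + b p) + (c p + d p)) + e p) \<le> ((nrm a + nrm b) + (nrm c + nrm d)) + nrm e"
    if "a \<in> V" "b \<in> V" "c \<in> V" "d \<in> V" "e \<in> V" for a b c d e
    using nrm_triangle[OF that(1,2)] nrm_triangle[OF that(3,4)]
      nrm_triangle[OF add[OF that(1,2)] add[OF that(3,4)]]
      nrm_triangle[OF add[OF add[OF that(1,2)] add[OF that(3,4)]] that(5)] by linarith
  have "nrm (L_op \<omega> u) \<le> ((nrm (?T (-1) (1,0)) + nrm (?T (-1) (-1,0))) +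
      (nrm (?T (-1) (0,1)) + nrm (?T (-1) (0,-1)))) + nrm (?T (4 - \<omega>) 0)"
    using tri[OF V[of "-1" "(1,0)"] V[of "-1" "(-1,0)"] V[of "-1" "(0,1)"] V[of "-1" "(0,-1)"]
      V[of "4 - \<omega>" 0]] unfolding L_op_split by simp
  also have "\<dots> = (4 + \<bar>4 - \<omega>\<bar>) * nrm u" by (simp only: n) (simp add: algebra_simps)
  also have "\<dots> \<le> (8 + \<bar>\<omega>\<bar>) * nrm u" by (intro mult_right_mono nrm_nonneg) auto
  finally show ?thesis .
qed

lemma grad_sq_summable:
  assumes "u \<in> V" shows "grad_sq u summable_on S"
  unfolding grad_sq_def[abs_def]
  using assms by (intro summable_on_add square_summable diff shift)

text \<open>Summation by parts. The inner product is exactly shift invariant, so there are no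
  boundary terms, even on a periodicity cell.\<close>

lemma ip_L_op_eq:
  assumes "u \<in> V"
  shows "ip (L_op \<omega> u) u = infsum (grad_sq u) S - \<omega> * ip u u"
proof -
  let ?T = "\<lambda>e p. u (p + e)"
  have V: "?T e \<in> V" for e using shift[OF assms] .
  have inv: "ip (?T e) (?T e) = ip u u" for e
    using inner_shift[OF assms assms] by (simp add: ip_def)
  \<comment> \<open>Shifting both arguments by \<open>e\<close> turns a backward neighbour into a
    forward one.\<close>
  have swap: "ip (?T (- e)) u = ip (?T e) u" for e
    using inner_shift[OF V[of "- e"] assms, of e]
    by (simp add: ip_def mult.commute)
  have D: "(\<Sum>\<^sub>\<infinity>p\<in>S. (?T e p - u p)\<^sup>2) = 2 * ip u u - 2 * ip (?T e) u" for e
  proof -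
    have "(\<Sum>\<^sub>\<infinity>p\<in>S. (?T e p - u p)\<^sup>2) = ip (\<lambda>p. ?T e p + - 1 * u p) (\<lambda>p. ?T e p + - 1 * u p)"
      by (simp add: ip_self)
    also have "\<dots> = 2 * ip u u - 2 * ip (?T e) u"
      using V[of e] assms scale[OF assms, of "-1"] add[OF V[of e] scale[OF assms, of "-1"]]
      by (simp only: ip_add_left ip_add_right ip_scale_left ip_scale_right inv ip_commute[of u "?T e"]) simp
    finally show ?thesis .
  qed
  have "infsum (grad_sq u) S = (2 * ip u u - 2 * ip (?T (1,0)) u) + (2 * ip u u - 2 * ip (?T (0,1)) u)"
    unfolding grad_sq_def[abs_def] D[symmetric]
    by (intro infsum_add square_summable diff V assms)
  moreover have "ip (L_op \<omega> u) u = - 2 * ip (?T (1,0)) u - 2 * ip (?T (0,1)) u + (4 - \<omega>) * ip u u"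
  proof -
    have sum5: "ip (\<lambda>p. ((a p + b p) + (c p + d p)) + e p) u = ((ip a u + ip b u) + (ip c u + ip d u)) + ip e u"
      if "a \<in> V" "b \<in> V" "c \<in> V" "d \<in> V" "e \<in> V" for a b c d e
      by (simp only: ip_add_left[OF add[OF add[OF that(1,2)] add[OF that(3,4)]] that(5) assms]
          ip_add_left[OF add[OF that(1,2)] add[OF that(3,4)] assms]
          ip_add_left[OF that(1,2) assms] ip_add_left[OF that(3,4) assms])
    have "ip (L_op \<omega> u) u = ((- 1 * ip (?T (1,0)) u + - 1 * ip (?T (- 1,0)) u) +
        (- 1 * ip (?T (0,1)) u + - 1 * ip (?T (0,- 1)) u)) + (4 - \<omega>) * ip u u"
      unfolding L_op_split
      by (subst sum5[OF scale[OF V] scale[OF V] scale[OF V] scale[OF V] scale[OF assms]])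
        (simp only: ip_scale_left)
    then show ?thesis using swap[of "(1,0)"] swap[of "(0,1)"] by simp
  qed
  ultimately show ?thesis by (simp add: algebra_simps)
qed

lemma ip_L_op_ge: "u \<in> V \<Longrightarrow> - \<omega> * ip u u \<le> ip (L_op \<omega> u) u"
  by (simp add: ip_L_op_eq infsum_nonneg grad_sq_nonneg)

lemma ip_L_op_le:
  assumes "u \<in> V" shows "ip (L_op \<omega> u) u \<le> (8 - \<omega>) * ip u u"
proof -
  let ?T = "\<lambda>e p. u (p + e)"
  have V: "?T e \<in> V" for e using shift[OF assms] .
  have inv: "(\<Sum>\<^sub>\<infinity>p\<in>S. (?T e p)\<^sup>2) = ip u u" for e
    using inner_shift[OF assms assms] by (simp add: ip_def power2_eq_square)
  have sq: "(x - y)\<^sup>2 \<le> 2 * x\<^sup>2 + 2 * y\<^sup>2" for x y :: real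
    using zero_le_power2[of "x + y"] by (simp add: power2_eq_square algebra_simps)
  have s: "(\<lambda>p. c * (?T e p)\<^sup>2) summable_on S" for c e
    using V by (intro summable_on_cmult_right square_summable)
  \<comment> \<open>\<open>?T 0\<close> is \<open>u\<close> itself, written as a shift so that one
    rule sums all three terms.\<close>
  have "infsum (grad_sq u) S \<le> (\<Sum>\<^sub>\<infinity>p\<in>S. (2 * (?T (1,0) p)\<^sup>2 + 2 * (?T (0,1) p)\<^sup>2) + 4 * (?T 0 p)\<^sup>2)"
  proof (rule infsum_mono)
    show "(\<lambda>p. (2 * (?T (1,0) p)\<^sup>2 + 2 * (?T (0,1) p)\<^sup>2) + 4 * (?T 0 p)\<^sup>2) summable_on S"
      by (intro summable_on_add s)
    show "grad_sq u p \<le> (2 * (?T (1,0) p)\<^sup>2 + 2 * (?T (0,1) p)\<^sup>2) + 4 * (?T 0 p)\<^sup>2" for p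
      using sq[of "?T (1,0) p" "u p"] sq[of "?T (0,1) p" "u p"] by (simp add: grad_sq_def)
  qed (rule grad_sq_summable[OF assms])
  also have "\<dots> = 8 * ip u u"
  proof -
    have c: "(\<Sum>\<^sub>\<infinity>p\<in>S. c * (?T e p)\<^sup>2) = c * ip u u" for c e
      by (simp only: infsum_cmult_right' inv)
    show ?thesis
      by (simp only: infsum_add[OF summable_on_add[OF s s] s] infsum_add[OF s s] c)
  qed
  finally show ?thesis by (simp add: ip_L_op_eq[OF assms] algebra_simps)
qed

text \<open>\<open>nehari\<close> asks for some Frechet derivative that vanishes on
  \<open>u\<close>; uniqueness allows the explicit one to be tested instead.\<close>

lemma frechet_derivative_unique:
  assumes D: "frechet_derivative_on V ip J u D" and D': "frechet_derivative_on V ip J u D'"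
    and "v \<in> V"
  shows "D v = D' v"
proof -
  have "\<bar>D v - D' v\<bar> \<le> 0 + e" if "e > 0" for e
  proof -
    \<comment> \<open>Makes \<open>2 * \<epsilon> * nrm v \<le> e\<close>; the added 1 covers
      \<open>nrm v = 0\<close>.\<close>
    define \<epsilon> where "\<epsilon> = e / (2 * (nrm v + 1))"
    have e: "\<epsilon> > 0" using that nrm_nonneg[of v] by (simp add: \<epsilon>_def)
    obtain \<delta> where d1: "\<delta> > 0"
      and *: "\<And>h. h \<in> V \<Longrightarrow> nrm h < \<delta> \<Longrightarrow> \<bar>J (\<lambda>p. u p + h p) - J u - D h\<bar> \<le> \<epsilon> * nrm h"
      using D e unfolding frechet_derivative_on_def by blast
    obtain \<delta>' where d2: "\<delta>' > 0"
      and **: "\<And>h. h \<in> V \<Longrightarrow> nrm h < \<delta>' \<Longrightarrow> \<bar>J (\<lambda>p. u p + h p) - J u - D' h\<bar> \<le> \<epsilon> * nrm h"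
      using D' e unfolding frechet_derivative_on_def by blast
    note d = d1 d2
    \<comment> \<open>Scales \<open>v\<close> into both balls; by homogeneity \<open>s\<close>
      cancels in the resulting estimate.\<close>
    define s where "s = min \<delta> \<delta>' / (nrm v + 1) / 2"
    have s: "s > 0" using d nrm_nonneg[of v] by (simp add: s_def)
    let ?h = "\<lambda>p. s * v p"
    have "nrm ?h = s * nrm v" using s by (simp add: nrm_scale)
    also have "\<dots> < s * (2 * (nrm v + 1))" using s nrm_nonneg[of v] by (intro mult_strict_left_mono) auto
    also have "\<dots> = min \<delta> \<delta>'" using nrm_nonneg[of v] by (simp add: s_def field_simps)
    finally have "nrm ?h < \<delta>" "nrm ?h < \<delta>'" by auto
    then have "\<bar>D ?h - D' ?h\<bar> \<le> 2 * \<epsilon> * nrm ?h"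
      using *[of ?h] **[of ?h] scale[OF \<open>v \<in> V\<close>, of s] by simp
    moreover have "D ?h = s * D v" "D' ?h = s * D' v"
      using D D' \<open>v \<in> V\<close> by (auto simp: frechet_derivative_on_def)
    ultimately have "s * \<bar>D v - D' v\<bar> \<le> s * (2 * \<epsilon> * nrm v)"
      using s by (simp add: nrm_scale abs_mult flip: right_diff_distrib)
    then have "\<bar>D v - D' v\<bar> \<le> 2 * \<epsilon> * nrm v" using s by simp
    also have "\<dots> \<le> e"
      using that nrm_nonneg[of v] by (simp add: \<epsilon>_def field_simps)
    finally show ?thesis by simp
  qed
  then have "\<bar>D v - D' v\<bar> \<le> 0" by (rule field_le_epsilon)
  then show ?thesis by simp
qed

end

section \<open>The functional and its Nehari set\<close>

lemma (in nonlinearity) abs_f_le: "\<bar>f t\<bar> \<le> l * \<bar>t\<bar>"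
proof (cases "t = 0")
  case False
  have "\<bar>f t\<bar> * \<bar>t\<bar> \<le> l * \<bar>t\<bar> * \<bar>t\<bar>"
    using f_mult_le[of t] f_mult_nonneg[of t] by (simp add: power2_eq_square mult.assoc flip: abs_mult)
  then show ?thesis using False by simp
qed simp

locale lattice_functional = lattice_space S V + nonlinearity f l for S V f l +
  fixes \<omega> :: real
begin

definition J :: "lattice_fun \<Rightarrow> real" where
  "J u = 1 / 2 * ip (L_op \<omega> u) u - (\<Sum>\<^sub>\<infinity>p\<in>S. primitive f (u p))"

lemma f_closed: "u \<in> V \<Longrightarrow> (\<lambda>p. f (u p)) \<in> V"
  by (rule compose[OF _ abs_f_le])

lemma f_mult_summable: "u \<in> V \<Longrightarrow> v \<in> V \<Longrightarrow> (\<lambda>p. f (u p) * v p) summable_on S"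
  by (rule mult_summable[OF f_closed])

lemma primitive_summable:
  assumes "u \<in> V" shows "(\<lambda>p. primitive f (u p)) summable_on S"
proof (rule summable_on_dominated)
  show "(\<lambda>p. l / 2 * (u p)\<^sup>2) summable_on S"
    using assms by (intro summable_on_cmult_right square_summable)
  show "\<bar>primitive f (u p)\<bar> \<le> l / 2 * (u p)\<^sup>2" for p
    using primitive_le[of "u p"] primitive_nonneg[of "u p"] by simp
qed

lemma G_summable:
  assumes "u \<in> V" shows "(\<lambda>p. G (u p)) summable_on S"
proof (rule summable_on_dominated)
  show "(\<lambda>p. l / 2 * (u p)\<^sup>2) summable_on S"
    using assms by (intro summable_on_cmult_right square_summable)
  show "\<bar>G (u p)\<bar> \<le> l / 2 * (u p)\<^sup>2" for p
    using G_le[of "u p"] G_nonneg[of "u p"] by simp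
qed

text \<open>The quadratic part is symmetrised because this is the linear term that the expansion of
  \<open>J\<close> produces directly; the symmetry of \<open>L_op\<close> does not have to be
  invoked.\<close>

definition DJ :: "lattice_fun \<Rightarrow> lattice_fun \<Rightarrow> real" where
  "DJ u h = 1 / 2 * (ip (L_op \<omega> u) h + ip (L_op \<omega> h) u) - ip (\<lambda>p. f (u p)) h"

lemma J_remainder:
  assumes "u \<in> V"
  obtains K where "K > 0"
    "\<And>h. h \<in> V \<Longrightarrow> nrm h \<le> 1 \<Longrightarrow> \<bar>J (\<lambda>p. u p + h p) - J u - DJ u h\<bar> \<le> K * (nrm h)\<^sup>2"
proof -
  \<comment> \<open>A perturbation of norm at most 1 keeps all values on \<open>S\<close> within
    \<open>nrm u + 1\<close>, where \<open>f\<close> is Lipschitz.\<close>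
  obtain K where K: "K > 0"
    "\<And>s t. \<bar>s\<bar> \<le> nrm u + 1 \<Longrightarrow> \<bar>t\<bar> \<le> nrm u + 1 \<Longrightarrow> \<bar>f s - f t\<bar> \<le> K * \<bar>s - t\<bar>"
    using f_locally_lipschitz by blast
  let ?C = "1 / 2 * (8 + \<bar>\<omega>\<bar>) + K"
  show ?thesis
  proof (rule that[of ?C])
    show "?C > 0" using K(1) by (intro add_nonneg_pos mult_nonneg_nonneg) auto
    fix h assume h: "h \<in> V" "nrm h \<le> 1"
    let ?r = "\<lambda>p. primitive f (u p + h p) - primitive f (u p) - f (u p) * h p"
    have uh: "(\<lambda>p. u p + h p) \<in> V" by (rule add[OF assms h(1)])
    note L = L_op_closed[OF assms, of \<omega>] L_op_closed[OF h(1), of \<omega>]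
    have "ip (L_op \<omega> (\<lambda>p. u p + h p)) (\<lambda>p. u p + h p) =
        ip (L_op \<omega> u) u + ip (L_op \<omega> u) h + (ip (L_op \<omega> h) u + ip (L_op \<omega> h) h)"
      unfolding L_op_add
      by (simp only: ip_add_left[OF L uh] ip_add_right[OF assms h(1) L(1)] ip_add_right[OF assms h(1) L(2)])
    moreover have "infsum ?r S = (\<Sum>\<^sub>\<infinity>p\<in>S. primitive f (u p + h p)) - (\<Sum>\<^sub>\<infinity>p\<in>S. primitive f (u p)) -
        ip (\<lambda>p. f (u p)) h"
      unfolding ip_def
      by (simp only: infsum_diff[OF summable_on_diff[OF primitive_summable[OF uh] primitive_summable[OF assms]]
          f_mult_summable[OF assms h(1)]] infsum_diff[OF primitive_summable[OF uh] primitive_summable[OF assms]])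
    ultimately have eq: "J (\<lambda>p. u p + h p) - J u - DJ u h = 1 / 2 * ip (L_op \<omega> h) h - infsum ?r S"
      by (simp add: J_def DJ_def algebra_simps)
    have "\<bar>ip (L_op \<omega> h) h\<bar> \<le> (8 + \<bar>\<omega>\<bar>) * nrm h * nrm h"
      using Cauchy_Schwarz[OF L(2) h(1)] mult_right_mono[OF nrm_L_op_le[OF h(1), of \<omega>] nrm_nonneg[of h]]
      by linarith
    moreover have "\<bar>infsum ?r S\<bar> \<le> (\<Sum>\<^sub>\<infinity>p\<in>S. K * (h p)\<^sup>2)"
    proof (rule abs_infsum_le)
      show "(\<lambda>p. K * (h p)\<^sup>2) summable_on S"
        by (intro summable_on_cmult_right square_summable h)
      fix p assume "p \<in> S"
      then have "\<bar>u p\<bar> \<le> nrm u" "\<bar>h p\<bar> \<le> 1"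
        using pointwise_le_nrm[OF assms, of p] pointwise_le_nrm[OF h(1), of p] h(2) by auto
      then show "\<bar>?r p\<bar> \<le> K * (h p)\<^sup>2"
        by (intro primitive_remainder[where M = "nrm u + 1", OF K(2) K(1)]) auto
    qed
    moreover have "(\<Sum>\<^sub>\<infinity>p\<in>S. K * (h p)\<^sup>2) = K * (nrm h)\<^sup>2"
      by (simp add: infsum_cmult_right' nrm_sq ip_self)
    ultimately show "\<bar>J (\<lambda>p. u p + h p) - J u - DJ u h\<bar> \<le> ?C * (nrm h)\<^sup>2"
      unfolding eq by (simp add: power2_eq_square algebra_simps)
  qed
qed

lemma frechet_derivative_J:
  assumes "u \<in> V"
  shows "frechet_derivative_on V ip J u (DJ u)"
  unfolding frechet_derivative_on_def
proof (intro conjI ballI allI impI)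
  note L = L_op_closed[where \<omega> = \<omega>]
  note fu = f_closed[OF assms]
  show "DJ u (\<lambda>p. v p + w p) = DJ u v + DJ u w" if "v \<in> V" "w \<in> V" for v w
    unfolding DJ_def L_op_add
    using that assms by (simp add: ip_add_left ip_add_right L fu algebra_simps)
  show "DJ u (\<lambda>p. a * v p) = a * DJ u v" for a v
    unfolding DJ_def L_op_scale by (simp add: ip_scale_left ip_scale_right algebra_simps)
  show "\<exists>C. \<forall>v\<in>V. \<bar>DJ u v\<bar> \<le> C * nrm v"
  proof (intro exI ballI)
    fix v assume v: "v \<in> V"
    have "\<bar>ip (L_op \<omega> u) v\<bar> \<le> (8 + \<bar>\<omega>\<bar>) * nrm u * nrm v"
      using Cauchy_Schwarz[OF L[OF assms] v] mult_right_mono[OF nrm_L_op_le[OF assms, of \<omega>] nrm_nonneg[of v]]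
      by linarith
    moreover have "\<bar>ip (L_op \<omega> v) u\<bar> \<le> (8 + \<bar>\<omega>\<bar>) * nrm v * nrm u"
      using Cauchy_Schwarz[OF L[OF v] assms] mult_right_mono[OF nrm_L_op_le[OF v, of \<omega>] nrm_nonneg[of u]]
      by linarith
    moreover have "\<bar>ip (\<lambda>p. f (u p)) v\<bar> \<le> nrm (\<lambda>p. f (u p)) * nrm v"
      by (rule Cauchy_Schwarz[OF fu v])
    ultimately show "\<bar>DJ u v\<bar> \<le> ((8 + \<bar>\<omega>\<bar>) * nrm u + nrm (\<lambda>p. f (u p))) * nrm v"
      unfolding DJ_def by (simp add: algebra_simps)
  qed
  fix \<epsilon> :: real assume "\<epsilon> > 0"
  obtain K where K: "K > 0"
    "\<And>h. h \<in> V \<Longrightarrow> nrm h \<le> 1 \<Longrightarrow> \<bar>J (\<lambda>p. u p + h p) - J u - DJ u h\<bar> \<le> K * (nrm h)\<^sup>2"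
    using J_remainder[OF assms] by blast
  show "\<exists>\<delta>>0. \<forall>h\<in>V. nrm h < \<delta> \<longrightarrow> \<bar>J (\<lambda>p. u p + h p) - J u - DJ u h\<bar> \<le> \<epsilon> * nrm h"
  \<comment> \<open>The bound 1 makes the quadratic remainder estimate applicable, the other one
    makes \<open>K * nrm h \<le> \<epsilon>\<close>.\<close>
  proof (intro exI[of _ "min 1 (\<epsilon> / K)"] conjI ballI impI)
    show "0 < min 1 (\<epsilon> / K)" using \<open>\<epsilon> > 0\<close> K(1) by simp
    fix h assume h: "h \<in> V" "nrm h < min 1 (\<epsilon> / K)"
    then have "\<bar>J (\<lambda>p. u p + h p) - J u - DJ u h\<bar> \<le> (K * nrm h) * nrm h"
      using K(2)[of h] by (simp add: power2_eq_square mult.assoc)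
    also have "\<dots> \<le> \<epsilon> * nrm h"
      using h(2) K(1) by (intro mult_right_mono nrm_nonneg) (simp add: field_simps)
    finally show "\<bar>J (\<lambda>p. u p + h p) - J u - DJ u h\<bar> \<le> \<epsilon> * nrm h" .
  qed
qed

text \<open>Existence and uniqueness of the Frechet derivative collapse the existential quantifier
  to the Nehari identity, the form used from here on.\<close>

lemma nehari_iff:
  "u \<in> nehari V ip J \<longleftrightarrow>
     u \<in> V \<and> u \<noteq> (\<lambda>p. 0) \<and> ip (L_op \<omega> u) u = (\<Sum>\<^sub>\<infinity>p\<in>S. f (u p) * u p)"
proof (cases "u \<in> V")
  case True
  have "(\<exists>D. frechet_derivative_on V ip J u D \<and> D u = 0) \<longleftrightarrow> DJ u u = 0"
    using frechet_derivative_J[OF True] frechet_derivative_unique[OF _ _ True] by metis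
  then show ?thesis using True by (simp add: nehari_def DJ_def) (simp add: ip_def)
qed (simp add: nehari_def)

lemma J_nehari:
  assumes "u \<in> V" "ip (L_op \<omega> u) u = (\<Sum>\<^sub>\<infinity>p\<in>S. f (u p) * u p)"
  shows "J u = (\<Sum>\<^sub>\<infinity>p\<in>S. G (u p))"
proof -
  have "(\<Sum>\<^sub>\<infinity>p\<in>S. G (u p)) = (\<Sum>\<^sub>\<infinity>p\<in>S. 1 / 2 * (f (u p) * u p)) - (\<Sum>\<^sub>\<infinity>p\<in>S. primitive f (u p))"
    unfolding energy_density_def mult.assoc
    by (intro infsum_diff summable_on_cmult_right f_mult_summable primitive_summable assms)
  then show ?thesis by (simp only: J_def assms(2) infsum_cmult_right')
qed

lemma solution_identity:
  assumes "solves_eq \<omega> f u"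
  shows "ip (L_op \<omega> u) u = (\<Sum>\<^sub>\<infinity>p\<in>S. f (u p) * u p)"
  using assms by (simp only: ip_def L_op_def solves_eq_def)

end

section \<open>The two concrete spaces\<close>

lemma bij_shift: "bij (\<lambda>p. p + e :: 'a :: group_add)"
  by (rule bij_betw_byWitness[where f' = "\<lambda>p. p - e"]) auto

interpretation ell2: lattice_space UNIV ell2
proof
  show "(\<lambda>p. u p + v p) \<in> ell2" if "u \<in> ell2" "v \<in> ell2" for u v
  proof -
    have "(\<lambda>p. (u p + v p)\<^sup>2) summable_on UNIV"
    proof (rule summable_on_dominated)
      show "(\<lambda>p. 2 * (u p)\<^sup>2 + 2 * (v p)\<^sup>2) summable_on UNIV"
        using that unfolding ell2_def by (intro summable_on_add summable_on_cmult_right) auto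
      have "(x + y)\<^sup>2 \<le> 2 * x\<^sup>2 + 2 * y\<^sup>2" for x y :: real
        using zero_le_power2[of "x - y"] by (simp add: power2_eq_square algebra_simps)
      then show "\<bar>(u p + v p)\<^sup>2\<bar> \<le> 2 * (u p)\<^sup>2 + 2 * (v p)\<^sup>2" for p by simp
    qed
    then show ?thesis by (simp add: ell2_def)
  qed
  show "(\<lambda>p. g (u p)) \<in> ell2" if "u \<in> ell2" "\<And>t. \<bar>g t\<bar> \<le> c * \<bar>t\<bar>" for u g and c :: real
  proof -
    have "(\<lambda>p. (g (u p))\<^sup>2) summable_on UNIV"
    proof (rule summable_on_dominated)
      show "(\<lambda>p. c\<^sup>2 * (u p)\<^sup>2) summable_on UNIV"
        using that unfolding ell2_def by (intro summable_on_cmult_right) auto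
      show "\<bar>(g (u p))\<^sup>2\<bar> \<le> c\<^sup>2 * (u p)\<^sup>2" for p
        using power_mono[OF that(2)[of "u p"], of 2] by (simp add: power_mult_distrib)
    qed
    then show ?thesis by (simp add: ell2_def)
  qed
  show "(\<lambda>p. u (p + e)) \<in> ell2" if "u \<in> ell2" for u e
    using that summable_on_reindex_bij_betw[OF bij_shift[of e], of "\<lambda>p. (u p)\<^sup>2"]
    by (simp add: ell2_def)
  show "(\<Sum>\<^sub>\<infinity>p. u (p + e) * v (p + e)) = (\<Sum>\<^sub>\<infinity>p. u p * v p)" for u v :: lattice_fun and e
    by (rule infsum_reindex_bij_betw[OF bij_shift[of e], of "\<lambda>p. u p * v p"])
qed (simp add: ell2_def)

lemma ell2_ip_eq: "ell2.ip = ell2_inner"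
  by (intro ext) (simp add: ell2.ip_def ell2_inner_def)

section \<open>Periodic functions and the periodicity cell\<close>

lemma periodic_add_mult:
  fixes g :: "int \<Rightarrow> 'a"
  assumes "\<And>n. g (n + k) = g n" shows "g (n + j * k) = g n"
proof (induction j rule: int_induct[where k = 0])
  case (step1 i)
  then show ?case using assms[of "n + i * k"] by (simp add: algebra_simps)
next
  case (step2 i)
  then show ?case using assms[of "n + (i - 1) * k"] by (simp add: algebra_simps)
qed simp

text \<open>When the window moves by one site, the value that enters at \<open>lo + k\<close> equals
  the one that leaves at \<open>lo\<close>. General shifts follow by induction in both
  directions.\<close>

lemma sum_periodic_shift:
  fixes g :: "int \<Rightarrow> real"
  assumes per: "\<And>n. g (n + k) = g n" and "k > 0"
  shows "(\<Sum>n\<in>{lo..lo + k - 1}. g (n + e)) = (\<Sum>n\<in>{lo..lo + k - 1}. g n)"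
proof -
  have step: "(\<Sum>n\<in>{lo..lo + k - 1}. h (n + 1)) = (\<Sum>n\<in>{lo..lo + k - 1}. h n)"
    if "\<And>n. h (n + k) = h n" for h :: "int \<Rightarrow> real"
  proof -
    have "(\<Sum>n\<in>{lo..lo + k - 1}. h (n + 1)) = (\<Sum>n\<in>{lo + 1..lo + k}. h n)"
      by (rule sum.reindex_bij_witness[of _ "\<lambda>n. n - 1" "\<lambda>n. n + 1"]) auto
    also have "{lo + 1..lo + k} = insert (lo + k) {lo + 1..lo + k - 1}" using \<open>k > 0\<close> by auto
    also have "(\<Sum>n\<in>insert (lo + k) {lo + 1..lo + k - 1}. h n) = h lo + (\<Sum>n\<in>{lo + 1..lo + k - 1}. h n)"
      using that[of lo] by simp
    also have "\<dots> = (\<Sum>n\<in>insert lo {lo + 1..lo + k - 1}. h n)" by simp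
    also have "insert lo {lo + 1..lo + k - 1} = {lo..lo + k - 1}" using \<open>k > 0\<close> by auto
    finally show ?thesis .
  qed
  have per': "g (n + k + e) = g (n + e)" for n e
    using per[of "n + e"] by (simp add: algebra_simps)
  show ?thesis
  proof (induction e rule: int_induct[where k = 0])
    case (step1 i)
    then show ?case using step[of "\<lambda>n. g (n + i)"] per' by (simp add: algebra_simps)
  next
    case (step2 i)
    have "(\<Sum>n\<in>{lo..lo + k - 1}. g (n + 1 + (i - 1))) = (\<Sum>n\<in>{lo..lo + k - 1}. g (n + (i - 1)))"
      by (rule step[of "\<lambda>n. g (n + (i - 1))"], rule per')
    then show ?case using step2 by simp
  qed simp
qed

lemma finite_per_cell [simp]: "finite (per_cell k1 k2)"
  by (simp add: per_cell_def)

lemma sum_per_cell_shift: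
  assumes "g \<in> per_space k1 k2" "k1 > 0" "k2 > 0"
  shows "(\<Sum>p\<in>per_cell k1 k2. g (p + e)) = (\<Sum>p\<in>per_cell k1 k2. g p)"
proof -
  obtain a b where e: "e = (a, b)" by (cases e)
  let ?A = "{- (k1 div 2)..- (k1 div 2) + k1 - 1}" and ?B = "{- (k2 div 2)..- (k2 div 2) + k2 - 1}"
  have cell: "per_cell k1 k2 = ?A \<times> ?B" by (simp add: per_cell_def algebra_simps)
  have per: "g (n + k1, m) = g (n, m)" "g (n, m + k2) = g (n, m)" for n m
    using assms(1) by (auto simp: per_space_def)
  have "(\<Sum>p\<in>per_cell k1 k2. g (p + e)) = (\<Sum>n\<in>?A. \<Sum>m\<in>?B. g (n + a, m + b))"
    by (simp add: cell e sum.cartesian_product case_prod_unfold plus_prod_def)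
  also have "\<dots> = (\<Sum>n\<in>?A. \<Sum>m\<in>?B. g (n + a, m))"
    by (intro sum.cong refl sum_periodic_shift per(2) assms(3))
  also have "\<dots> = (\<Sum>n\<in>?A. \<Sum>m\<in>?B. g (n, m))"
    using per(1) assms(2)
    by (intro sum_periodic_shift[of "\<lambda>n. \<Sum>m\<in>?B. g (n, m)"] sum.cong refl) auto
  also have "\<dots> = (\<Sum>p\<in>per_cell k1 k2. g p)"
    by (simp add: cell sum.cartesian_product)
  finally show ?thesis .
qed

lemma lattice_space_per:
  assumes "k1 > 0" "k2 > 0"
  shows "lattice_space (per_cell k1 k2) (per_space k1 k2)"
proof
  show sh: "(\<lambda>p. u (p + e)) \<in> per_space k1 k2" if "u \<in> per_space k1 k2" for u e
  proof -
    obtain a b where e: "e = (a, b)" by (cases e)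
    have per: "u (n + k1, m) = u (n, m)" "u (n, m + k2) = u (n, m)" for n m
      using that by (auto simp: per_space_def)
    have "u (n + k1 + a, m + b) = u (n + a, m + b)" "u (n + a, m + k2 + b) = u (n + a, m + b)" for n m
      using per(1)[of "n + a" "m + b"] per(2)[of "n + a" "m + b"] by (simp_all add: ac_simps)
    then show ?thesis by (simp add: per_space_def e)
  qed
  show "(\<Sum>\<^sub>\<infinity>p\<in>per_cell k1 k2. u (p + e) * v (p + e)) = (\<Sum>\<^sub>\<infinity>p\<in>per_cell k1 k2. u p * v p)"
    if "u \<in> per_space k1 k2" "v \<in> per_space k1 k2" for u v e
    using sum_per_cell_shift[of "\<lambda>p. u p * v p" k1 k2 e] that assms by (simp add: per_space_def)
qed (auto simp: per_space_def)

text \<open>The representative of \<open>n\<close> modulo \<open>k\<close> in the cell; the offset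
  \<open>k div 2\<close> matches the asymmetric end points of \<open>per_cell\<close>.\<close>

definition per_reduce :: "int \<Rightarrow> int \<Rightarrow> int" where
  "per_reduce k n = (n + k div 2) mod k - k div 2"

lemma per_reduce_add: "per_reduce k (n + k) = per_reduce k n"
proof -
  have "(n + k + k div 2) mod k = (n + k div 2) mod k"
    using mod_add_self2[of "n + k div 2" k] by (simp add: algebra_simps)
  then show ?thesis by (simp add: per_reduce_def)
qed

lemma per_reduce_in_cell:
  "k1 > 0 \<Longrightarrow> k2 > 0 \<Longrightarrow> (per_reduce k1 n, per_reduce k2 m) \<in> per_cell k1 k2"
  using pos_mod_bound[of k1 "n + k1 div 2"] pos_mod_bound[of k2 "m + k2 div 2"]
  by (simp add: per_cell_def per_reduce_def)

lemma per_reduce_id: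
  "(n, m) \<in> per_cell k1 k2 \<Longrightarrow> per_reduce k1 n = n \<and> per_reduce k2 m = m"
  by (auto simp: per_cell_def per_reduce_def intro!: mod_pos_pos_trivial)

lemma per_space_reduce:
  assumes "u \<in> per_space k1 k2"
  shows "u (per_reduce k1 n, per_reduce k2 m) = u (n, m)"
proof -
  have red: "per_reduce k n = n + - ((n + k div 2) div k) * k" for k n
    using div_mult_mod_eq[of "n + k div 2" k] unfolding per_reduce_def by linarith
  have "u (n + i * k1, m + j * k2) = u (n, m)" for i j
    using periodic_add_mult[of "\<lambda>n. u (n, m + j * k2)" k1 n i]
      periodic_add_mult[of "\<lambda>m. u (n, m)" k2 m j] assms by (simp add: per_space_def)
  then show ?thesis unfolding red .
qed

context nonlinearity
begin

lemma lattice_functional_ell2: "lattice_functional UNIV ell2 f l"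
  by unfold_locales

lemma lattice_functional_per:
  "k1 > 0 \<Longrightarrow> k2 > 0 \<Longrightarrow> lattice_functional (per_cell k1 k2) (per_space k1 k2) f l"
  by (intro lattice_functional.intro lattice_space_per nonlinearity_axioms)

lemma nehari_ell2_iff:
  "u \<in> nehari_ell2 \<omega> f \<longleftrightarrow>
     u \<in> ell2 \<and> u \<noteq> (\<lambda>p. 0) \<and> ell2_inner (L_op \<omega> u) u = (\<Sum>\<^sub>\<infinity>p. f (u p) * u p)"
proof -
  interpret E: lattice_functional UNIV ell2 f l \<omega> by (rule lattice_functional_ell2)
  have "E.J = J_ell2 \<omega> f"
    by (intro ext) (simp add: E.J_def J_ell2_def ell2_ip_eq)
  then show ?thesis
    using E.nehari_iff by (simp add: nehari_ell2_def ell2_ip_eq)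
qed

lemma J_ell2_nehari:
  assumes "u \<in> nehari_ell2 \<omega> f"
  shows "J_ell2 \<omega> f u = (\<Sum>\<^sub>\<infinity>p. G (u p))"
proof -
  interpret E: lattice_functional UNIV ell2 f l \<omega> by (rule lattice_functional_ell2)
  show ?thesis
    using E.J_nehari[of u] assms by (simp add: nehari_ell2_iff E.J_def J_ell2_def ell2_ip_eq)
qed

lemma nehari_per_iff:
  assumes "k1 > 0" "k2 > 0"
  shows "u \<in> nehari_per \<omega> f k1 k2 \<longleftrightarrow>
     u \<in> per_space k1 k2 \<and> u \<noteq> (\<lambda>p. 0) \<and>
     per_inner k1 k2 (L_op \<omega> u) u = (\<Sum>p\<in>per_cell k1 k2. f (u p) * u p)"
proof -
  interpret P: lattice_functional "per_cell k1 k2" "per_space k1 k2" f l \<omega>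
    by (rule lattice_functional_per[OF assms])
  have ip: "P.ip = per_inner k1 k2"
    by (intro ext) (simp add: P.ip_def per_inner_def)
  have "P.J = J_per \<omega> f k1 k2"
    by (intro ext) (simp add: P.J_def J_per_def ip)
  then show ?thesis
    using P.nehari_iff by (simp add: nehari_per_def ip)
qed

lemma J_per_nehari:
  assumes "k1 > 0" "k2 > 0" "u \<in> nehari_per \<omega> f k1 k2"
  shows "J_per \<omega> f k1 k2 u = (\<Sum>p\<in>per_cell k1 k2. G (u p))"
proof -
  interpret P: lattice_functional "per_cell k1 k2" "per_space k1 k2" f l \<omega>
    by (rule lattice_functional_per[OF assms(1,2)])
  have ip: "P.ip = per_inner k1 k2"
    by (intro ext) (simp add: P.ip_def per_inner_def)
  show ?thesis
    using P.J_nehari[of u] assms by (simp add: nehari_per_iff P.J_def J_per_def ip)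
qed

end

section \<open>The spectrum of the discrete Laplacian\<close>

lemma infsum_finite_support:
  fixes g :: "'a \<Rightarrow> real"
  assumes "finite B" "\<And>p. p \<in> A - B \<Longrightarrow> g p = 0" "B \<subseteq> A"
  shows "infsum g A = sum g B" "g summable_on A"
proof -
  have "infsum g A = infsum g B" using assms by (intro infsum_cong_neutral) auto
  then show "infsum g A = sum g B" using assms(1) by simp
  have "g summable_on A \<longleftrightarrow> g summable_on B" using assms by (intro summable_on_cong_neutral) auto
  then show "g summable_on A" using assms(1) by simp
qed

lemma infsum_restrict_finite:
  fixes g :: "'a \<Rightarrow> real"
  assumes "finite B"
  shows "(\<lambda>p. if p \<in> B then g p else 0) summable_on UNIV"
    and "(\<Sum>\<^sub>\<infinity>p. if p \<in> B then g p else 0) = sum g B"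
  using infsum_finite_support[OF assms, of UNIV "\<lambda>p. if p \<in> B then g p else 0"] by simp_all

lemma finite_support_in_ell2:
  assumes "finite B" "\<And>p. p \<notin> B \<Longrightarrow> u p = 0" shows "u \<in> ell2"
  unfolding ell2_def using infsum_finite_support(2)[OF assms(1), of UNIV "\<lambda>p. (u p)\<^sup>2"] assms(2) by simp

definition lattice_box :: "int \<Rightarrow> (int \<times> int) set" where
  "lattice_box N = {- N..N} \<times> {- N..N}"

lemma finite_lattice_box [simp]: "finite (lattice_box N)"
  by (simp add: lattice_box_def)

lemma card_lattice_box: "N \<ge> 0 \<Longrightarrow> real (card (lattice_box N)) = (2 * real_of_int N + 1)\<^sup>2"
  by (simp add: lattice_box_def card_cartesian_product power2_eq_square)

text \<open>A generalized eigenfunction \<open>t (\<theta> (n + m))\<close> cut off to a box; only the boundary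
  layer of the box contributes to its image under \<open>L_op\<close>.\<close>

definition cutoff_wave :: "(real \<Rightarrow> real) \<Rightarrow> real \<Rightarrow> int \<Rightarrow> lattice_fun" where
  "cutoff_wave t \<theta> N = (\<lambda>(n, m). if (n, m) \<in> lattice_box N then t (\<theta> * real_of_int (n + m)) else 0)"

text \<open>Only sites between the boxes of radius N - 1 and N + 1 contribute. Their number is (2 N
  + 3)^2 - (2 N - 1)^2 = 8 (2 N + 1), and each value is at most 8: four neighbours of size at most
  1, and a diagonal factor of size at most 4.\<close>

lemma cutoff_wave_defect:
  assumes bound: "\<And>x. \<bar>t x\<bar> \<le> 1" and wave: "\<And>x. t (x + \<theta>) + t (x - \<theta>) = 2 * cos \<theta> * t x"
    and \<mu>: "cos \<theta> = 1 - \<mu> / 4" and "N \<ge> 1"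
  shows "ell2_inner (L_op \<mu> (cutoff_wave t \<theta> N)) (L_op \<mu> (cutoff_wave t \<theta> N)) \<le> 512 * (2 * real_of_int N + 1)"
proof -
  let ?u = "cutoff_wave t \<theta> N"
  have in_box: "?u (n, m) = t (\<theta> * real_of_int (n + m))" if "\<bar>n\<bar> \<le> N" "\<bar>m\<bar> \<le> N" for n m
    using that by (auto simp: cutoff_wave_def lattice_box_def)
  have le1: "\<bar>?u p\<bar> \<le> 1" for p
    using bound by (auto simp: cutoff_wave_def split: prod.split)
  have inner: "L_op \<mu> ?u p = 0" if "p \<in> lattice_box (N - 1)" for p
  proof -
    obtain n m where p: "p = (n, m)" by (cases p)
    then have nm: "\<bar>n\<bar> \<le> N - 1" "\<bar>m\<bar> \<le> N - 1" using that by (auto simp: lattice_box_def)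
    define x where "x = \<theta> * real_of_int (n + m)"
    have "?u (n + 1, m) = t (x + \<theta>)" "?u (n, m + 1) = t (x + \<theta>)"
      "?u (n - 1, m) = t (x - \<theta>)" "?u (n, m - 1) = t (x - \<theta>)" "?u (n, m) = t x"
      using nm by (subst in_box; simp add: x_def algebra_simps)+
    then have "L_op \<mu> ?u p = - 2 * (t (x + \<theta>) + t (x - \<theta>)) + (4 - \<mu>) * t x"
      by (simp add: p L_op_def laplacian_def algebra_simps)
    also have "\<dots> = 0" unfolding wave \<mu> by (simp add: algebra_simps)
    finally show ?thesis .
  qed
  have outer: "L_op \<mu> ?u p = 0" if "p \<notin> lattice_box (N + 1)" for p
  proof -
    obtain n m where p: "p = (n, m)" by (cases p)
    show ?thesis using that
      by (auto simp: p L_op_def laplacian_def cutoff_wave_def lattice_box_def)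
  qed
  have \<mu>': "0 \<le> \<mu>" "\<mu> \<le> 8"
    using \<mu> cos_le_one[of \<theta>] cos_ge_minus_one[of \<theta>] by linarith+
  have bnd: "(L_op \<mu> ?u p)\<^sup>2 \<le> 64" for p
  proof -
    have "\<bar>(4 - \<mu>) * ?u p\<bar> \<le> 4 * 1"
      unfolding abs_mult using \<mu>' le1 by (intro mult_mono) auto
    then have "\<bar>L_op \<mu> ?u p\<bar> \<le> 8"
      using le1[of "p + (1, 0)"] le1[of "p + (- 1, 0)"] le1[of "p + (0, 1)"] le1[of "p + (0, - 1)"]
      unfolding L_op_def laplacian_shift left_diff_distrib by linarith
    from power_mono[OF this, of 2] show ?thesis by simp
  qed
  have "ell2_inner (L_op \<mu> ?u) (L_op \<mu> ?u) = (\<Sum>p\<in>lattice_box (N + 1) - lattice_box (N - 1). (L_op \<mu> ?u p)\<^sup>2)"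
    unfolding ell2_inner_def power2_eq_square
    by (rule infsum_finite_support) (use inner outer in auto)
  also have "\<dots> \<le> real (card (lattice_box (N + 1) - lattice_box (N - 1))) * 64"
    by (rule sum_bounded_above) (use bnd in auto)
  also have "real (card (lattice_box (N + 1) - lattice_box (N - 1))) = real (card (lattice_box (N + 1))) - real (card (lattice_box (N - 1)))"
  proof -
    have "lattice_box (N - 1) \<subseteq> lattice_box (N + 1)" by (auto simp: lattice_box_def)
    then show ?thesis by (simp add: card_Diff_subset card_mono of_nat_diff)
  qed
  also have "(\<dots>) * 64 = 512 * (2 * real_of_int N + 1)"
    using \<open>N \<ge> 1\<close> by (simp add: card_lattice_box power2_eq_square algebra_simps)
  finally show ?thesis .
qed

text \<open>A Weyl sequence: the mass of the cut off waves grows like N^2, their defect only like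
  N.\<close>

lemma cutoff_wave_not_bounded_below:
  assumes "0 \<le> \<mu>" "\<mu> \<le> 8"
  shows "\<not> (\<exists>C. \<forall>u\<in>ell2. norm_of ell2_inner u \<le> C * norm_of ell2_inner (L_op \<mu> u))"
proof
  assume "\<exists>C. \<forall>u\<in>ell2. norm_of ell2_inner u \<le> C * norm_of ell2_inner (L_op \<mu> u)"
  then obtain C where C: "\<And>u. u \<in> ell2 \<Longrightarrow> norm_of ell2_inner u \<le> C * norm_of ell2_inner (L_op \<mu> u)"
    by blast
  note nrm_sq = ell2.nrm_sq[unfolded ell2_ip_eq] and nrm_nonneg = ell2.nrm_nonneg[unfolded ell2_ip_eq]
  have C2: "ell2_inner u u \<le> C\<^sup>2 * ell2_inner (L_op \<mu> u) (L_op \<mu> u)" if "u \<in> ell2" for u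
    using power_mono[OF C[OF that] nrm_nonneg, of 2] by (simp add: power_mult_distrib nrm_sq)
  \<comment> \<open>Solves 4 - 4 cos \<theta> = \<mu>, where the left side is the symbol of minus
    the Laplacian at the frequency (\<theta>, \<theta>).\<close>
  define \<theta> where "\<theta> = arccos (1 - \<mu> / 4)"
  have \<theta>: "cos \<theta> = 1 - \<mu> / 4" using assms by (simp add: \<theta>_def)
  obtain N :: int where N: "N \<ge> 1" "1024 * C\<^sup>2 < real_of_int N"
  proof
    show "max 1 (\<lfloor>1024 * C\<^sup>2\<rfloor> + 1) \<ge> 1" by simp
    show "1024 * C\<^sup>2 < real_of_int (max 1 (\<lfloor>1024 * C\<^sup>2\<rfloor> + 1))" by linarith
  qed
  \<comment> \<open>Cosine and sine are used together because their squares add up to 1 at every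
    site, so the joint mass is the size of the box. The two defects give the constant 1024 = 2 *
    512.\<close>
  let ?u = "cutoff_wave cos \<theta> N" and ?v = "cutoff_wave sin \<theta> N"
  have mem: "cutoff_wave t \<theta> N \<in> ell2" for t
    by (rule finite_support_in_ell2[of "lattice_box N"]) (auto simp: cutoff_wave_def)
  have self: "ell2_inner (cutoff_wave t \<theta> N) (cutoff_wave t \<theta> N) =
      (\<Sum>p\<in>lattice_box N. (cutoff_wave t \<theta> N p)\<^sup>2)" for t
    unfolding ell2_inner_def power2_eq_square
    by (rule infsum_finite_support) (auto simp: cutoff_wave_def)
  have "ell2_inner ?u ?u + ell2_inner ?v ?v = (\<Sum>p\<in>lattice_box N. (?u p)\<^sup>2 + (?v p)\<^sup>2)"
    by (simp only: self sum.distrib)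
  also have "\<dots> = (\<Sum>p\<in>lattice_box N. 1)"
    by (intro sum.cong refl) (auto simp: cutoff_wave_def)
  finally have "(2 * real_of_int N + 1)\<^sup>2 = ell2_inner ?u ?u + ell2_inner ?v ?v"
    using N(1) by (simp add: card_lattice_box)
  also have "\<dots> \<le> C\<^sup>2 * (512 * (2 * real_of_int N + 1)) + C\<^sup>2 * (512 * (2 * real_of_int N + 1))"
  proof (rule add_mono)
    show "ell2_inner ?u ?u \<le> C\<^sup>2 * (512 * (2 * real_of_int N + 1))"
      by (rule order_trans[OF C2[OF mem]], intro mult_left_mono cutoff_wave_defect \<theta> N(1))
        (auto simp: cos_add cos_diff)
    show "ell2_inner ?v ?v \<le> C\<^sup>2 * (512 * (2 * real_of_int N + 1))"
      by (rule order_trans[OF C2[OF mem]], intro mult_left_mono cutoff_wave_defect \<theta> N(1))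
        (auto simp: sin_add sin_diff)
  qed
  also have "\<dots> = (1024 * C\<^sup>2) * (2 * real_of_int N + 1)" by simp
  also have "\<dots> < (2 * real_of_int N + 1) * (2 * real_of_int N + 1)"
    using N by (intro mult_strict_right_mono) auto
  finally show False by (simp add: power2_eq_square)
qed

text \<open>Subtracting \<open>c\<close> turns \<open>L_op \<omega>\<close> into
  \<open>L_op (\<omega> + c)\<close> with \<open>\<omega> + c\<close> in [0, 8], where the waves
  rule out a bounded inverse.\<close>

lemma ell2_spectrum_L_op:
  assumes "- \<omega> \<le> c" "c \<le> 8 - \<omega>"
  shows "c \<in> ell2_spectrum (L_op \<omega>)"
proof -
  have "(\<lambda>p. L_op \<omega> u p - c * u p) = L_op (\<omega> + c) u" for u
    by (auto simp: L_op_def algebra_simps)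
  then show ?thesis
    using cutoff_wave_not_bounded_below[of "\<omega> + c"] assms by (auto simp: ell2_spectrum_def)
qed

section \<open>Comparison of the periodic and the infinite levels\<close>

lemma finite_subset_lattice_box:
  assumes "finite B" obtains R where "R \<ge> 0" "B \<subseteq> lattice_box R"
proof
  let ?R = "\<Sum>p\<in>B. \<bar>fst p\<bar> + \<bar>snd p\<bar>"
  show "?R \<ge> 0" by (intro sum_nonneg) auto
  show "B \<subseteq> lattice_box ?R"
  proof
    fix p assume "p \<in> B"
    then have "\<bar>fst p\<bar> + \<bar>snd p\<bar> \<le> ?R"
      by (intro member_le_sum[of p B "\<lambda>p. \<bar>fst p\<bar> + \<bar>snd p\<bar>"] assms) auto
    then show "p \<in> lattice_box ?R" by (cases p) (auto simp: lattice_box_def)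
  qed
qed

lemma lattice_box_subset_per_cell:
  assumes "2 * R + 2 \<le> k1" "2 * R + 2 \<le> k2" shows "lattice_box R \<subseteq> per_cell k1 k2"
proof -
  have "R \<le> k div 2 \<and> R \<le> k - k div 2 - 1" if "2 * R + 2 \<le> k" for k :: int
    using that by linarith
  from this[OF assms(1)] this[OF assms(2)] show ?thesis
    unfolding lattice_box_def per_cell_def by (intro Sigma_mono) auto
qed

context nonlinearity
begin

text \<open>Along the ray through \<open>\<phi>\<close> the quadratic form dominates near 0 and the
  nonlinear term dominates at \<open>\<phi>\<close>, so the ray meets the Nehari set at a scale at
  most 1. There the energy is no larger, since \<open>G\<close> increases along rays.\<close>

lemma periodic_competitor:
  assumes "\<omega> < 0" and B: "finite B" "\<And>p. p \<notin> B \<Longrightarrow> \<phi> p = 0"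
    and below: "ell2_inner (L_op \<omega> \<phi>) \<phi> < (\<Sum>p\<in>B. f (\<phi> p) * \<phi> p)"
  obtains k0 where "\<And>k1 k2. k0 \<le> k1 \<Longrightarrow> k0 \<le> k2 \<Longrightarrow>
    \<exists>\<psi>\<in>nehari_per \<omega> f k1 k2. J_per \<omega> f k1 k2 \<psi> \<le> (\<Sum>p\<in>B. G (\<phi> p))"
proof -
  obtain R where R: "R \<ge> 0" "B \<subseteq> lattice_box R" using finite_subset_lattice_box[OF B(1)] .
  define Q where "Q = ell2_inner (L_op \<omega> \<phi>) \<phi>"
  have \<phi>: "\<phi> \<in> ell2" using B by (rule finite_support_in_ell2)
  have Q_sum: "Q = (\<Sum>p\<in>B. L_op \<omega> \<phi> p * \<phi> p)"
    unfolding Q_def ell2_inner_def by (rule infsum_finite_support) (use B in auto)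
  have "ell2_inner \<phi> \<phi> = (\<Sum>p\<in>B. (\<phi> p)\<^sup>2)"
    unfolding ell2_inner_def power2_eq_square by (rule infsum_finite_support) (use B in auto)
  then have Q_ge: "- \<omega> * (\<Sum>p\<in>B. (\<phi> p)\<^sup>2) \<le> Q"
    using ell2.ip_L_op_ge[OF \<phi>, of \<omega>] by (simp add: ell2_ip_eq Q_def)
  then have "Q \<ge> 0"
    using \<open>\<omega> < 0\<close> by (intro order_trans[OF _ Q_ge] mult_nonneg_nonneg sum_nonneg) auto
  have "\<exists>p\<in>B. \<phi> p \<noteq> 0"
  proof (rule ccontr)
    assume "\<not> ?thesis"
    then have "(\<Sum>p\<in>B. f (\<phi> p) * \<phi> p) = 0" by simp
    then show False using below \<open>Q \<ge> 0\<close> by (simp add: Q_def)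
  qed
  then obtain p0 where p0: "p0 \<in> B" "\<phi> p0 \<noteq> 0" by blast
  \<comment> \<open>The derivative of the functional at \<open>t * \<phi>\<close>, applied to
    \<open>t * \<phi>\<close>; its zeros are the scales on the Nehari set.\<close>
  define h where "h t = t\<^sup>2 * Q - (\<Sum>p\<in>B. f (t * \<phi> p) * (t * \<phi> p))" for t
  obtain \<delta> where \<delta>: "\<delta> > 0" "\<And>t. \<bar>t\<bar> \<le> \<delta> \<Longrightarrow> f t * t \<le> - \<omega> / 2 * t\<^sup>2"
    using f_mult_small[of "- \<omega>"] \<open>\<omega> < 0\<close> by auto
  define M where "M = (\<Sum>p\<in>B. \<bar>\<phi> p\<bar>) + 1"
  have M: "M > 0" by (simp add: M_def sum_nonneg add_nonneg_pos)
  have \<phi>_le: "\<bar>\<phi> p\<bar> \<le> M" if "p \<in> B" for p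
    using member_le_sum[of p B "\<lambda>p. \<bar>\<phi> p\<bar>"] that B(1) by (simp add: M_def)
  \<comment> \<open>At this scale all values are at most \<open>\<delta>\<close>, where the
    nonlinear term is absorbed by the quadratic form.\<close>
  define t0 where "t0 = min 1 (\<delta> / M)"
  have t0: "0 < t0" "t0 \<le> 1" "t0 \<le> \<delta> / M" using \<delta>(1) M by (auto simp: t0_def)
  have "0 \<le> h t0"
  proof -
    have "(\<Sum>p\<in>B. f (t0 * \<phi> p) * (t0 * \<phi> p)) \<le> (\<Sum>p\<in>B. t0\<^sup>2 * (- \<omega> * (\<phi> p)\<^sup>2))"
    proof (rule sum_mono)
      fix p assume "p \<in> B"
      then have "\<bar>t0 * \<phi> p\<bar> \<le> \<delta> / M * M"
        using t0 \<phi>_le M \<delta>(1) unfolding abs_mult by (intro mult_mono) auto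
      then have "f (t0 * \<phi> p) * (t0 * \<phi> p) \<le> - \<omega> / 2 * (t0 * \<phi> p)\<^sup>2"
        using M by (intro \<delta>(2)) simp
      also have "\<dots> \<le> - \<omega> * (t0 * \<phi> p)\<^sup>2" using \<open>\<omega> < 0\<close> by (intro mult_right_mono) auto
      finally show "f (t0 * \<phi> p) * (t0 * \<phi> p) \<le> t0\<^sup>2 * (- \<omega> * (\<phi> p)\<^sup>2)"
        by (simp add: power_mult_distrib mult.commute mult.left_commute)
    qed
    also have "\<dots> = t0\<^sup>2 * (- \<omega> * (\<Sum>p\<in>B. (\<phi> p)\<^sup>2))"
      by (simp only: sum_distrib_left)
    also have "\<dots> \<le> t0\<^sup>2 * Q" by (rule mult_left_mono[OF Q_ge]) simp
    finally show ?thesis by (simp add: h_def)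
  qed
  moreover have "h 1 \<le> 0" using below by (simp add: h_def Q_def)
  moreover have "continuous_on {t0..1} h"
    unfolding h_def[abs_def]
    by (intro continuous_intros continuous_on_compose2[OF continuous_on_f[of UNIV]]) auto
  ultimately obtain t where t: "t0 \<le> t" "t \<le> 1" "h t = 0"
    using IVT2'[of h 1 0 t0] t0(2) by auto
  show ?thesis
  \<comment> \<open>This is \<open>2 * (R + 1) + 2\<close>: the cell contains the support together
    with all its neighbours, so periodic copies of \<open>\<phi>\<close> do not interact.\<close>
  proof (rule that[of "2 * R + 4"])
    fix k1 k2 :: int assume k: "2 * R + 4 \<le> k1" "2 * R + 4 \<le> k2"
    then have kpos: "k1 > 0" "k2 > 0" using R by auto
    have cell: "lattice_box (R + 1) \<subseteq> per_cell k1 k2" by (rule lattice_box_subset_per_cell) (use k in auto)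
    have "lattice_box R \<subseteq> lattice_box (R + 1)" by (auto simp: lattice_box_def)
    then have B_cell: "B \<subseteq> per_cell k1 k2" using R(2) cell by auto
    \<comment> \<open>The periodic extension of \<open>\<phi>\<close> from the cell.\<close>
    define \<psi>0 where "\<psi>0 = (\<lambda>(n, m). \<phi> (per_reduce k1 n, per_reduce k2 m))"
    have \<psi>0_cell: "\<psi>0 p = \<phi> p" if "p \<in> per_cell k1 k2" for p
      using that per_reduce_id by (cases p) (simp add: \<psi>0_def)
    define \<psi> where "\<psi> = (\<lambda>p. t * \<psi>0 p)"
    have per: "\<psi> \<in> per_space k1 k2"
      by (simp add: per_space_def \<psi>_def \<psi>0_def per_reduce_add)
    have nz: "\<psi> \<noteq> (\<lambda>p. 0)"
    proof -
      have "\<psi> p0 \<noteq> 0"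
        using p0(2) t(1) t0(1) \<psi>0_cell[OF subsetD[OF B_cell p0(1)]] by (simp add: \<psi>_def)
      then show ?thesis by auto
    qed
    have sum_cell: "(\<Sum>p\<in>per_cell k1 k2. g (\<psi> p)) = (\<Sum>p\<in>B. g (t * \<phi> p))" if "g 0 = 0" for g :: "real \<Rightarrow> real"
      using B_cell B(2) that by (intro sum.mono_neutral_cong_right) (auto simp: \<psi>_def \<psi>0_cell)
    have L_eq: "L_op \<omega> \<psi>0 p = L_op \<omega> \<phi> p" if "p \<in> B" for p
    proof -
      have "p + e \<in> lattice_box (R + 1)" if "e \<in> {(1,0),(-1,0),(0,1),(0,-1),(0,0)}" for e
        using R(2) \<open>p \<in> B\<close> that by (cases p) (auto simp: lattice_box_def)
      then have "\<psi>0 (p + e) = \<phi> (p + e)" if "e \<in> {(1,0),(-1,0),(0,1),(0,-1),(0,0)}" for e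
        using cell that by (intro \<psi>0_cell) blast
      then have "\<psi>0 (p + (1,0)) = \<phi> (p + (1,0))" "\<psi>0 (p + (-1,0)) = \<phi> (p + (-1,0))"
         "\<psi>0 (p + (0,1)) = \<phi> (p + (0,1))" "\<psi>0 (p + (0,-1)) = \<phi> (p + (0,-1))"
        by blast+
      moreover have "\<psi>0 p = \<phi> p" using \<psi>0_cell[OF subsetD[OF B_cell \<open>p \<in> B\<close>]] .
      ultimately show ?thesis by (simp only: L_op_def laplacian_shift)
    qed
    have "per_inner k1 k2 (L_op \<omega> \<psi>) \<psi> = (\<Sum>p\<in>per_cell k1 k2. t\<^sup>2 * (L_op \<omega> \<psi>0 p * \<psi>0 p))"
      by (simp add: per_inner_def \<psi>_def ell2.L_op_scale power2_eq_square mult.assoc mult.left_commute)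
    also have "\<dots> = (\<Sum>p\<in>B. t\<^sup>2 * (L_op \<omega> \<phi> p * \<phi> p))"
      using B_cell B(2) by (intro sum.mono_neutral_cong_right) (auto simp: \<psi>0_cell L_eq)
    also have "\<dots> = t\<^sup>2 * Q" by (simp only: Q_sum sum_distrib_left)
    also have "\<dots> = (\<Sum>p\<in>per_cell k1 k2. f (\<psi> p) * \<psi> p)"
      using t(3) sum_cell[of "\<lambda>x. f x * x"] by (simp add: h_def)
    finally have neh: "\<psi> \<in> nehari_per \<omega> f k1 k2"
      using per nz by (simp add: nehari_per_iff[OF kpos])
    have "J_per \<omega> f k1 k2 \<psi> = (\<Sum>p\<in>B. G (t * \<phi> p))"
      using J_per_nehari[OF kpos neh] sum_cell[of G] by simp
    also have "\<dots> \<le> (\<Sum>p\<in>B. G (1 * \<phi> p))"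
      using t t0 by (intro sum_mono G_mono) auto
    finally show "\<exists>\<psi>\<in>nehari_per \<omega> f k1 k2. J_per \<omega> f k1 k2 \<psi> \<le> (\<Sum>p\<in>B. G (\<phi> p))"
      using neh by auto
  qed
qed

text \<open>The dilation makes the nonlinear sum exceed the quadratic form by \<open>gap\<close>.
  The set \<open>B\<close> is so large that the cutoff raises the form by at most half of the gap
  and lowers the sum by less than half of it.\<close>

lemma nehari_ell2_truncation:
  assumes v: "v \<in> nehari_ell2 \<omega> f" and "t0 > 1"
  obtains B where "finite B"
    "ell2_inner (L_op \<omega> (\<lambda>p. if p \<in> B then t0 * v p else 0)) (\<lambda>p. if p \<in> B then t0 * v p else 0)
      < (\<Sum>p\<in>B. f (t0 * v p) * (t0 * v p))"
proof -
  interpret E: lattice_functional UNIV ell2 f l \<omega> by (rule lattice_functional_ell2)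
  have v': "v \<in> ell2" "v \<noteq> (\<lambda>p. 0)" "ell2.ip (L_op \<omega> v) v = (\<Sum>\<^sub>\<infinity>p. f (v p) * v p)"
    using v by (auto simp: nehari_ell2_iff ell2_ip_eq)
  define w where "w = (\<lambda>p. t0 * v p)"
  have w: "w \<in> ell2" unfolding w_def by (rule ell2.scale[OF v'(1)])
  define gap where "gap = (\<Sum>\<^sub>\<infinity>p. f (w p) * w p) - ell2.ip (L_op \<omega> w) w"
  \<comment> \<open>The Nehari identity of \<open>v\<close> rewrites \<open>gap\<close> as the sum
    of \<open>?d\<close>, which is nonnegative everywhere and positive wherever \<open>v\<close> is
    nonzero.\<close>
  have "gap > 0"
  proof -
    let ?d = "\<lambda>p. f (w p) * w p - t0\<^sup>2 * (f (v p) * v p)"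
    have s: "(\<lambda>p. f (w p) * w p) summable_on UNIV" "(\<lambda>p. t0\<^sup>2 * (f (v p) * v p)) summable_on UNIV"
      by (intro E.f_mult_summable w) (intro summable_on_cmult_right E.f_mult_summable v')
    have d0: "0 \<le> ?d p" for p
      using f_mult_strict_mono[of "v p" t0] \<open>t0 > 1\<close> by (cases "v p = 0") (auto simp: w_def)
    obtain p0 where "v p0 \<noteq> 0" using v'(2) by (metis ext)
    then have "0 < ?d p0"
      using f_mult_strict_mono[of "v p0" t0] \<open>t0 > 1\<close> by (auto simp: w_def)
    also have "sum ?d {p0} \<le> infsum ?d UNIV"
      by (rule finite_sum_le_infsum) (use summable_on_diff[OF s] d0 in auto)
    then have "?d p0 \<le> infsum ?d UNIV" by simp
    also have "infsum ?d UNIV = gap"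
      unfolding infsum_diff[OF s] gap_def
      by (simp only: infsum_cmult_right' flip: v'(3)) (simp add: w_def ell2.L_op_scale
          ell2.ip_scale_left ell2.ip_scale_right power2_eq_square mult.assoc)
    finally show ?thesis .
  qed
  define K where K: "K = 8 + \<bar>\<omega>\<bar>"
  have K0: "K > 0" by (simp add: K add_pos_nonneg)
  \<comment> \<open>Bounds the norm of the removed part \<open>h\<close>. The form changes by at
    most \<open>\<eta> * (2 * K * ell2.nrm w + K)\<close>, where \<open>\<eta> \<le> 1\<close> was
    used to replace \<open>\<eta>\<^sup>2\<close> by \<open>\<eta>\<close>.\<close>
  define \<eta> where "\<eta> = min 1 (gap / (2 * (2 * K * ell2.nrm w + K)))"
  have K1: "2 * K * ell2.nrm w + K > 0" by (rule add_nonneg_pos) (use K0 in \<open>auto simp: ell2.nrm_nonneg\<close>)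
  have \<eta>: "\<eta> > 0" "\<eta> \<le> 1" "\<eta> * (2 * K * ell2.nrm w + K) \<le> gap / 2"
  proof -
    show "\<eta> > 0" "\<eta> \<le> 1" using \<open>gap > 0\<close> K1 by (auto simp: \<eta>_def)
    have "\<eta> * (2 * K * ell2.nrm w + K) \<le> gap / (2 * (2 * K * ell2.nrm w + K)) * (2 * K * ell2.nrm w + K)"
      using K1 by (intro mult_right_mono) (auto simp: \<eta>_def)
    also have "\<dots> = gap / 2" using K1 by (simp del: distrib_left_numeral)
    finally show "\<eta> * (2 * K * ell2.nrm w + K) \<le> gap / 2" .
  qed
  obtain B1 where B1: "finite B1"
    "\<And>C. finite C \<Longrightarrow> B1 \<subseteq> C \<Longrightarrow> \<bar>(\<Sum>\<^sub>\<infinity>p. (w p)\<^sup>2) - (\<Sum>p\<in>C. (w p)\<^sup>2)\<bar> < \<eta>\<^sup>2"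
    using finite_tail_less[OF ell2.square_summable[OF w], of "\<eta>\<^sup>2"] \<eta>(1) by auto
  obtain B2 where B2: "finite B2"
    "\<And>C. finite C \<Longrightarrow> B2 \<subseteq> C \<Longrightarrow> \<bar>(\<Sum>\<^sub>\<infinity>p. f (w p) * w p) - (\<Sum>p\<in>C. f (w p) * w p)\<bar> < gap / 2"
    using finite_tail_less[OF E.f_mult_summable[OF w w], of "gap / 2"] \<open>gap > 0\<close> by auto
  define B where "B = B1 \<union> B2"
  have fin: "finite B" using B1 B2 by (simp add: B_def)
  define h where "h = (\<lambda>p. if p \<in> B then 0 else - w p)"
  let ?wB = "\<lambda>p. if p \<in> B then w p else 0"
  have wB: "?wB \<in> ell2" using finite_support_in_ell2[OF fin] by simp
  have wBh: "?wB = (\<lambda>p. w p + h p)" by (auto simp: h_def)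
  have h: "h \<in> ell2"
    using ell2.diff[OF wB w] by (rule back_subst[of "\<lambda>h. h \<in> ell2"]) (auto simp: h_def)
  have "(ell2.nrm h)\<^sup>2 = (\<Sum>\<^sub>\<infinity>p. (w p)\<^sup>2 - (if p \<in> B then (w p)\<^sup>2 else 0))"
    unfolding ell2.nrm_sq ell2.ip_self by (intro infsum_cong) (auto simp: h_def)
  also have "\<dots> = (\<Sum>\<^sub>\<infinity>p. (w p)\<^sup>2) - (\<Sum>\<^sub>\<infinity>p. if p \<in> B then (w p)\<^sup>2 else 0)"
    by (intro infsum_diff ell2.square_summable w infsum_finite_support(2)[OF fin]) auto
  also have "(\<Sum>\<^sub>\<infinity>p. if p \<in> B then (w p)\<^sup>2 else 0) = (\<Sum>p\<in>B. (w p)\<^sup>2)"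
    by (subst infsum_finite_support(1)[OF fin]) auto
  also have "(\<Sum>\<^sub>\<infinity>p. (w p)\<^sup>2) - (\<Sum>p\<in>B. (w p)\<^sup>2) < \<eta>\<^sup>2"
    using B1(2)[OF fin] unfolding abs_less_iff by (simp add: B_def)
  finally have "(ell2.nrm h)\<^sup>2 \<le> \<eta>\<^sup>2" by (rule less_imp_le)
  then have hn: "ell2.nrm h \<le> \<eta>" using \<eta>(1) by (rule power2_le_imp_le[OF _ less_imp_le])
  note L = ell2.L_op_closed[OF w, of \<omega>] ell2.L_op_closed[OF h, of \<omega>]
  have "ell2.ip (L_op \<omega> ?wB) ?wB =
      ell2.ip (L_op \<omega> w) w + ell2.ip (L_op \<omega> w) h + (ell2.ip (L_op \<omega> h) w + ell2.ip (L_op \<omega> h) h)"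
    unfolding wBh ell2.L_op_add
    by (simp only: ell2.ip_add_left[OF L ell2.add[OF w h]] ell2.ip_add_right[OF w h L(1)]
        ell2.ip_add_right[OF w h L(2)])
  also have "\<dots> \<le> ell2.ip (L_op \<omega> w) w + K * ell2.nrm w * \<eta> + (K * ell2.nrm w * \<eta> + K * \<eta>)"
  proof -
    have b: "ell2.ip (L_op \<omega> x) y \<le> K * ell2.nrm x * ell2.nrm y" if "x \<in> ell2" "y \<in> ell2" for x y
      using abs_le_D1[OF ell2.Cauchy_Schwarz[OF ell2.L_op_closed[OF that(1)] that(2), of \<omega>]]
        mult_right_mono[OF ell2.nrm_L_op_le[OF that(1), of \<omega>] ell2.nrm_nonneg[of y]]
      unfolding K by linarith
    have 1: "K * ell2.nrm w * ell2.nrm h \<le> K * ell2.nrm w * \<eta>"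
      using hn K0 ell2.nrm_nonneg by (intro mult_left_mono mult_nonneg_nonneg) auto
    have 2: "K * ell2.nrm h * ell2.nrm h \<le> K * \<eta> * 1"
      using hn \<eta> K0 ell2.nrm_nonneg by (intro mult_mono mult_nonneg_nonneg) auto
    have 3: "K * ell2.nrm h * ell2.nrm w = K * ell2.nrm w * ell2.nrm h" by simp
    show ?thesis
      using b[OF w h] b[OF h w] b[OF h h] 1 2 unfolding 3 by linarith
  qed
  also have "\<dots> = ell2.ip (L_op \<omega> w) w + \<eta> * (2 * K * ell2.nrm w + K)" by (simp add: algebra_simps)
  also have "\<dots> \<le> ell2.ip (L_op \<omega> w) w + gap / 2" using \<eta>(3) by simp
  also have "\<dots> = (\<Sum>\<^sub>\<infinity>p. f (w p) * w p) - gap / 2" using gap_def by linarith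
  also have "\<dots> < (\<Sum>p\<in>B. f (w p) * w p)"
    using B2(2)[OF fin] unfolding abs_less_iff by (auto simp: B_def)
  finally show ?thesis
    using that[OF fin] by (simp only: ell2_ip_eq w_def)
qed

lemma periodic_level_upper_bound:
  assumes "\<omega> < 0" and v: "v \<in> nehari_ell2 \<omega> f" and "\<epsilon> > 0"
  obtains k0 where "\<And>k1 k2. k0 \<le> k1 \<Longrightarrow> k0 \<le> k2 \<Longrightarrow>
    \<exists>\<psi>\<in>nehari_per \<omega> f k1 k2. J_per \<omega> f k1 k2 \<psi> \<le> J_ell2 \<omega> f v + \<epsilon>"
proof -
  interpret E: lattice_functional UNIV ell2 f l \<omega> by (rule lattice_functional_ell2)
  have v': "v \<in> ell2" using v by (simp add: nehari_ell2_iff)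
  obtain K where K: "K > 0"
    "\<And>s t. \<bar>t\<bar> \<le> ell2.nrm v \<Longrightarrow> 1 \<le> s \<Longrightarrow> s \<le> 2 \<Longrightarrow> G (s * t) \<le> G t + K * (s - 1) * t\<^sup>2"
    using G_scale_close[of "ell2.nrm v"] by blast
  define Z where "Z = K * ell2.ip v v + 1"
  have Z: "Z > 0" using K(1) ell2.ip_self_nonneg[of v] by (simp add: Z_def add_nonneg_pos)
  \<comment> \<open>So close to 1 that \<open>(s - 1) * (K * ell2.ip v v) \<le> \<epsilon>\<close>,
    and at most 2 as \<open>K\<close> requires.\<close>
  define s where "s = 1 + min 1 (\<epsilon> / Z)"
  have s: "1 < s" "s \<le> 2" using \<open>\<epsilon> > 0\<close> Z by (auto simp: s_def)
  obtain B where B: "finite B"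
    "ell2_inner (L_op \<omega> (\<lambda>p. if p \<in> B then s * v p else 0)) (\<lambda>p. if p \<in> B then s * v p else 0)
      < (\<Sum>p\<in>B. f (s * v p) * (s * v p))"
    using nehari_ell2_truncation[OF v s(1)] by blast
  let ?\<phi> = "\<lambda>p. if p \<in> B then s * v p else 0"
  obtain k0 where k0: "\<And>k1 k2. k0 \<le> k1 \<Longrightarrow> k0 \<le> k2 \<Longrightarrow>
    \<exists>\<psi>\<in>nehari_per \<omega> f k1 k2. J_per \<omega> f k1 k2 \<psi> \<le> (\<Sum>p\<in>B. G (?\<phi> p))"
    using periodic_competitor[OF \<open>\<omega> < 0\<close> B(1), of ?\<phi>] B(2) by auto
  have sv: "(\<lambda>p. s * v p) \<in> ell2" by (rule ell2.scale[OF v'])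
  have "(\<Sum>p\<in>B. G (?\<phi> p)) = (\<Sum>p\<in>B. G (s * v p))" by (intro sum.cong) auto
  also have "\<dots> \<le> (\<Sum>\<^sub>\<infinity>p. G (s * v p))"
    by (rule finite_sum_le_infsum) (use E.G_summable[OF sv] B G_nonneg in auto)
  also have "\<dots> \<le> (\<Sum>\<^sub>\<infinity>p. G (v p) + K * (s - 1) * (v p)\<^sup>2)"
    using s by (intro infsum_mono summable_on_add summable_on_cmult_right E.G_summable[OF sv]
        E.G_summable[OF v'] ell2.square_summable[OF v'] K(2) ell2.pointwise_le_nrm[OF v']) auto
  also have "\<dots> = (\<Sum>\<^sub>\<infinity>p. G (v p)) + (\<Sum>\<^sub>\<infinity>p. K * (s - 1) * (v p)\<^sup>2)"
    by (intro infsum_add summable_on_cmult_right E.G_summable[OF v'] ell2.square_summable[OF v'])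
  also have "\<dots> = J_ell2 \<omega> f v + (s - 1) * (K * ell2.ip v v)"
    by (simp add: J_ell2_nehari[OF v] infsum_cmult_right' ell2.ip_self mult_ac)
  also have "(s - 1) * (K * ell2.ip v v) \<le> (\<epsilon> / Z) * Z"
    using s K(1) Z \<open>\<epsilon> > 0\<close> ell2.ip_self_nonneg[of v] by (intro mult_mono) (auto simp: s_def Z_def)
  finally have "(\<Sum>p\<in>B. G (?\<phi> p)) \<le> J_ell2 \<omega> f v + \<epsilon>" using Z by simp
  then show ?thesis using that[of k0] k0 order_trans by blast
qed

text \<open>A competitor on one site: a bump of height \<open>t\<close> has quadratic form
  \<open>(4 - \<omega>) * t\<^sup>2\<close>, which the nonlinear term exceeds for large
  \<open>t\<close> because the slope tends to \<open>l\<close>.\<close>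

lemma periodic_level_bounded:
  assumes "\<omega> < 0" and "4 - \<omega> < l"
  obtains E k0 where "\<And>k1 k2. k0 \<le> k1 \<Longrightarrow> k0 \<le> k2 \<Longrightarrow>
    \<exists>\<psi>\<in>nehari_per \<omega> f k1 k2. J_per \<omega> f k1 k2 \<psi> \<le> E"
proof -
  have "eventually (\<lambda>t. 4 - \<omega> < f t / t) at_top"
    using h2 assms(2) by (intro order_tendstoD(1)) (auto simp: h2_def)
  then have "eventually (\<lambda>t. 4 - \<omega> < f t / t \<and> t > 0) at_top"
    using eventually_gt_at_top by (rule eventually_conj)
  then obtain t where t: "4 - \<omega> < f t / t" "t > 0"
    unfolding eventually_at_top_linorder by auto
  define \<phi> :: lattice_fun where "\<phi> = (\<lambda>p. if p = 0 then t else 0)"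
  have "ell2_inner (L_op \<omega> \<phi>) \<phi> = (\<Sum>p\<in>{0}. L_op \<omega> \<phi> p * \<phi> p)"
    unfolding ell2_inner_def by (rule infsum_finite_support) (auto simp: \<phi>_def)
  also have "\<dots> = (4 - \<omega>) * t * t"
    by (simp add: \<phi>_def L_op_def laplacian_shift zero_prod_def algebra_simps)
  also have "\<dots> < f t / t * t * t"
    using t by (intro mult_strict_right_mono) auto
  also have "\<dots> = (\<Sum>p\<in>{0}. f (\<phi> p) * \<phi> p)"
    using t by (simp add: \<phi>_def)
  finally obtain k0 where "\<And>k1 k2. k0 \<le> k1 \<Longrightarrow> k0 \<le> k2 \<Longrightarrow>
    \<exists>\<psi>\<in>nehari_per \<omega> f k1 k2. J_per \<omega> f k1 k2 \<psi> \<le> (\<Sum>p\<in>{0}. G (\<phi> p))"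
    using periodic_competitor[OF assms(1), of "{0}" \<phi>] by (auto simp: \<phi>_def)
  then show ?thesis by (rule that)
qed

end

section \<open>Bounds for periodic solutions\<close>

text \<open>Tychonoff in place of a diagonal argument: the product of intervals is compact, and
  countability of the index type makes the product first countable, hence the set sequentially
  compact.\<close>

lemma pointwise_convergent_subsequence:
  fixes w :: "nat \<Rightarrow> 'a :: countable \<Rightarrow> real"
  assumes "\<And>j p. \<bar>w j p\<bar> \<le> M"
  obtains r u where "strict_mono (r :: nat \<Rightarrow> nat)" "\<And>p. (\<lambda>j. w (r j) p) \<longlonglongrightarrow> u p"
proof -
  let ?K = "PiE UNIV (\<lambda>_::'a. {- M..M})"
  have "compactin (product_topology (\<lambda>_::'a. euclideanreal) UNIV) ?K"
    by (subst compactin_PiE) auto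
  then have "compact ?K"
    by (simp flip: euclidean_product_topology compactin_euclidean_iff)
  then have "seq_compact ?K" by (rule compact_imp_seq_compact)
  moreover have "w j \<in> ?K" for j
    using assms by (auto simp: abs_le_iff minus_le_iff)
  ultimately obtain u r where ur: "strict_mono (r :: nat \<Rightarrow> nat)" "(w \<circ> r) \<longlonglongrightarrow> u"
    using seq_compactE[of ?K w] by blast
  show ?thesis
  proof (rule that[OF ur(1)])
    fix p
    have "isCont (\<lambda>g :: 'a \<Rightarrow> real. g p) u"
      by (rule continuous_on_interior[OF continuous_on_product_coordinates]) simp
    from isCont_tendsto_compose[OF this ur(2)] show "(\<lambda>j. w (r j) p) \<longlonglongrightarrow> u p"
      by (simp add: o_def)
  qed
qed

lemma eventually_subset_per_cell:
  assumes "filterlim K1 at_top F" "filterlim K2 at_top F" "finite B"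
  shows "eventually (\<lambda>j. B \<subseteq> per_cell (K1 j) (K2 j)) F"
proof -
  obtain R where R: "R \<ge> 0" "B \<subseteq> lattice_box R" using finite_subset_lattice_box[OF assms(3)] .
  have "eventually (\<lambda>j. 2 * R + 2 \<le> K1 j) F" "eventually (\<lambda>j. 2 * R + 2 \<le> K2 j) F"
    using assms(1,2) by (auto simp: filterlim_at_top)
  then show ?thesis
    by eventually_elim (use lattice_box_subset_per_cell R(2) in blast)
qed

lemma translate_eq: "translate b c u = (\<lambda>p. u (p + (b, c)))"
  by (auto simp: translate_def)

lemma translate_per_space: "u \<in> per_space k1 k2 \<Longrightarrow> translate b c u \<in> per_space k1 k2"
proof -
  assume "u \<in> per_space k1 k2"
  then have per: "u (n + k1, m) = u (n, m)" "u (n, m + k2) = u (n, m)" for n m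
    by (auto simp: per_space_def)
  show ?thesis
    using per(1)[of "_ + b" "_ + c"] per(2)[of "_ + b" "_ + c"]
    by (simp add: per_space_def translate_def add.commute add.left_commute)
qed

lemma solves_eq_translate:
  assumes "solves_eq \<omega> f u" shows "solves_eq \<omega> f (translate b c u)"
proof -
  have "laplacian (translate b c u) p = laplacian u (p + (b, c))" for p
    by (cases p) (simp add: laplacian_def translate_def algebra_simps)
  then show ?thesis
    using assms unfolding solves_eq_def by (simp only: translate_eq) blast
qed

text \<open>A density for the Nehari identity. The product of \<open>L_op \<omega> u\<close> and
  \<open>u\<close> has the same sum on a lattice space but no pointwise lower bound of use; the
  gradient form is bounded below site by site wherever \<open>f\<close> is absorbed.\<close>

definition defect :: "real \<Rightarrow> (real \<Rightarrow> real) \<Rightarrow> lattice_fun \<Rightarrow> lattice_fun" where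
  "defect \<omega> f u p = grad_sq u p - \<omega> * (u p)\<^sup>2 - f (u p) * u p"

context lattice_functional
begin

lemma
  assumes "u \<in> V"
  shows defect_summable: "defect \<omega> f u summable_on S"
    and infsum_defect: "infsum (defect \<omega> f u) S = ip (L_op \<omega> u) u - (\<Sum>\<^sub>\<infinity>p\<in>S. f (u p) * u p)"
proof -
  note s = grad_sq_summable[OF assms] summable_on_cmult_right[OF square_summable[OF assms], of \<omega>]
    f_mult_summable[OF assms assms]
  show "defect \<omega> f u summable_on S"
    unfolding defect_def[abs_def] by (intro summable_on_diff s)
  show "infsum (defect \<omega> f u) S = ip (L_op \<omega> u) u - (\<Sum>\<^sub>\<infinity>p\<in>S. f (u p) * u p)"
    unfolding defect_def[abs_def] ip_L_op_eq[OF assms] ip_self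
    by (simp only: infsum_diff[OF summable_on_diff[OF s(1,2)] s(3)] infsum_diff[OF s(1,2)] infsum_cmult_right')
qed

end

context nonlinearity
begin

lemma sum_defect_periodic:
  assumes "k1 > 0" "k2 > 0" "u \<in> per_space k1 k2" "solves_eq \<omega> f u"
  shows "(\<Sum>p\<in>per_cell k1 k2. defect \<omega> f u p) = 0"
proof -
  interpret P: lattice_functional "per_cell k1 k2" "per_space k1 k2" f l \<omega>
    by (rule lattice_functional_per[OF assms(1,2)])
  show ?thesis
    using P.infsum_defect[OF assms(3)] P.solution_identity[OF assms(4)] by simp
qed

lemma defect_ge:
  "f (u p) * u p \<le> - \<omega> / 2 * (u p)\<^sup>2 \<Longrightarrow> - \<omega> / 2 * (u p)\<^sup>2 \<le> defect \<omega> f u p"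
  using grad_sq_nonneg[of u p] by (simp add: defect_def)

lemma per_space_nonzero_in_cell:
  assumes "k1 > 0" "k2 > 0" "u \<in> per_space k1 k2" "u \<noteq> (\<lambda>p. 0)"
  obtains p where "p \<in> per_cell k1 k2" "u p \<noteq> 0"
proof -
  obtain n m where "u (n, m) \<noteq> 0" using assms(4) by (metis ext surj_pair)
  then show ?thesis
    using that[OF per_reduce_in_cell[OF assms(1,2)]] per_space_reduce[OF assms(3)] by metis
qed

lemma periodic_solution_large_site:
  assumes "\<omega> < 0" and \<delta>: "\<And>t. \<bar>t\<bar> \<le> \<delta> \<Longrightarrow> f t * t \<le> - \<omega> / 2 * t\<^sup>2"
    and k: "k1 > 0" "k2 > 0" and u: "u \<in> per_space k1 k2" "u \<noteq> (\<lambda>p. 0)" "solves_eq \<omega> f u"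
  shows "\<exists>p. \<delta> < \<bar>u p\<bar>"
proof (rule ccontr)
  assume "\<not> ?thesis"
  then have ge: "- \<omega> / 2 * (u p)\<^sup>2 \<le> defect \<omega> f u p" for p
    by (intro defect_ge \<delta>) (metis not_less)
  then have nonneg: "0 \<le> defect \<omega> f u p" for p
    using \<open>\<omega> < 0\<close> by (intro order_trans[OF _ ge] mult_nonneg_nonneg) auto
  obtain q where q: "q \<in> per_cell k1 k2" "u q \<noteq> 0"
    using per_space_nonzero_in_cell[OF k u(1,2)] .
  have "0 < - \<omega> / 2 * (u q)\<^sup>2" using \<open>\<omega> < 0\<close> q(2) by (intro mult_pos_pos) auto
  also have "\<dots> \<le> defect \<omega> f u q" by (rule ge)
  also have "\<dots> \<le> (\<Sum>p\<in>per_cell k1 k2. defect \<omega> f u p)"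
    by (intro member_le_sum q nonneg) auto
  finally show False using sum_defect_periodic[OF k u(1,3)] by simp
qed

lemma periodic_solution_bounded:
  assumes "\<omega> < 0"
  obtains R where "\<And>k1 k2 u. k1 > 0 \<Longrightarrow> k2 > 0 \<Longrightarrow> u \<in> per_space k1 k2 \<Longrightarrow> solves_eq \<omega> f u \<Longrightarrow>
    (\<Sum>p\<in>per_cell k1 k2. G (u p)) \<le> E \<Longrightarrow> (\<Sum>p\<in>per_cell k1 k2. (u p)\<^sup>2) \<le> R"
proof -
  obtain \<delta> where \<delta>: "\<delta> > 0" "\<And>t. \<bar>t\<bar> \<le> \<delta> \<Longrightarrow> f t * t \<le> - \<omega> / 2 * t\<^sup>2"
    using f_mult_small[of "- \<omega>"] \<open>\<omega> < 0\<close> by auto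
  obtain \<eta> where \<eta>: "\<eta> > 0" "\<And>t. \<bar>t\<bar> \<ge> \<delta> \<Longrightarrow> \<eta> \<le> G t"
    using G_bounded_below[OF \<delta>(1)] by blast
  obtain M where M: "\<And>t. G t \<le> E \<Longrightarrow> \<bar>t\<bar> \<le> M"
    using G_sublevel_bounded[of E] by blast
  \<comment> \<open>At a site with \<delta> < |t| \<le> M the nonlinear term is at most
    \<open>l * M\<^sup>2\<close>, which is \<open>c * \<eta>\<close> and so at most
    \<open>c * G t\<close>: large sites are paid for by energy.\<close>
  define c where "c = l * M\<^sup>2 / \<eta>"
  have c: "c \<ge> 0" using l_pos \<eta>(1) by (simp add: c_def)
  have key: "f t * t \<le> - \<omega> / 2 * t\<^sup>2 + c * G t" if "G t \<le> E" for t
  proof (cases "\<bar>t\<bar> \<le> \<delta>")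
    case True
    then show ?thesis using \<delta>(2)[OF True] mult_nonneg_nonneg[OF c G_nonneg[of t]] by linarith
  next
    case False
    have "f t * t \<le> l * t\<^sup>2" by (rule f_mult_le)
    also have "\<dots> \<le> l * M\<^sup>2"
      using power_mono[OF M[OF that] abs_ge_zero, of 2] l_pos by (intro mult_left_mono) auto
    also have "\<dots> = c * \<eta>" using \<eta>(1) by (simp add: c_def)
    also have "\<dots> \<le> c * G t" using False by (intro mult_left_mono \<eta>(2) c) auto
    finally have "f t * t \<le> c * G t" .
    moreover have "0 \<le> - \<omega> / 2 * t\<^sup>2" using \<open>\<omega> < 0\<close> by (intro mult_nonneg_nonneg) auto
    ultimately show ?thesis by linarith
  qed
  show ?thesis
  \<comment> \<open>Summing \<open>key\<close> over the cell, where the defect sums to 0, leaves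
    \<open>- \<omega> / 2\<close> times the squared norm at most \<open>c * E\<close>, independently
    of the periods.\<close>
  proof (rule that[of "2 * c * E / (- \<omega>)"])
    fix k1 k2 u
    assume k: "k1 > 0" "k2 > 0" and u: "u \<in> per_space k1 k2" "solves_eq \<omega> f u"
      and E: "(\<Sum>p\<in>per_cell k1 k2. G (u p)) \<le> E"
    have GE: "G (u p) \<le> E" if "p \<in> per_cell k1 k2" for p
      using member_le_sum[of p "per_cell k1 k2" "\<lambda>p. G (u p)"] that G_nonneg E by fastforce
    have "0 = (\<Sum>p\<in>per_cell k1 k2. defect \<omega> f u p)"
      using sum_defect_periodic[OF k u] by simp
    also have "\<dots> \<ge> (\<Sum>p\<in>per_cell k1 k2. - \<omega> / 2 * (u p)\<^sup>2 - c * G (u p))"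
    proof (rule sum_mono)
      fix p assume "p \<in> per_cell k1 k2"
      then show "- \<omega> / 2 * (u p)\<^sup>2 - c * G (u p) \<le> defect \<omega> f u p"
        using key[OF GE] grad_sq_nonneg[of u p] by (fastforce simp: defect_def)
    qed
    finally have "- \<omega> / 2 * (\<Sum>p\<in>per_cell k1 k2. (u p)\<^sup>2) \<le> c * (\<Sum>p\<in>per_cell k1 k2. G (u p))"
      by (simp only: sum_subtractf sum_distrib_left diff_le_0_iff_le)
    also have "\<dots> \<le> c * E" by (rule mult_left_mono[OF E c])
    finally show "(\<Sum>p\<in>per_cell k1 k2. (u p)\<^sup>2) \<le> 2 * c * E / (- \<omega>)"
      using \<open>\<omega> < 0\<close> by (simp add: field_simps)
  qed
qed

lemma per_space_pointwise_le:
  assumes "k1 > 0" "k2 > 0" "u \<in> per_space k1 k2" "(\<Sum>p\<in>per_cell k1 k2. (u p)\<^sup>2) \<le> R"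
  shows "\<bar>u p\<bar> \<le> sqrt R"
proof -
  obtain n m where p: "p = (n, m)" by (cases p)
  let ?q = "(per_reduce k1 n, per_reduce k2 m)"
  have "(u ?q)\<^sup>2 \<le> (\<Sum>p\<in>per_cell k1 k2. (u p)\<^sup>2)"
    by (rule member_le_sum[of ?q _ "\<lambda>p. (u p)\<^sup>2"]) (auto intro: per_reduce_in_cell assms)
  also have "\<dots> \<le> R" by (rule assms(4))
  finally show ?thesis
    using per_space_reduce[OF assms(3)] by (intro real_le_rsqrt) (simp add: p)
qed

end

section \<open>Passage to the limit\<close>

context nonlinearity
begin

lemma ground_state_limit:
  fixes \<kappa>1 \<kappa>2 :: "nat \<Rightarrow> int" and w :: "nat \<Rightarrow> lattice_fun"
  assumes "\<omega> < 0" and \<delta>: "\<delta> > 0" "\<And>t. \<bar>t\<bar> \<le> \<delta> \<Longrightarrow> f t * t \<le> - \<omega> / 2 * t\<^sup>2"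
    and K1: "filterlim \<kappa>1 at_top sequentially" and K2: "filterlim \<kappa>2 at_top sequentially"
    and pos: "\<And>j. \<kappa>1 j > 0" "\<And>j. \<kappa>2 j > 0"
    and per: "\<And>j. w j \<in> per_space (\<kappa>1 j) (\<kappa>2 j)"
    and sol: "\<And>j. solves_eq \<omega> f (w j)"
    and large: "\<And>j. \<delta> < \<bar>w j 0\<bar>"
    and bounded: "\<And>j. (\<Sum>p\<in>per_cell (\<kappa>1 j) (\<kappa>2 j). (w j p)\<^sup>2) \<le> R"
    and minimal: "\<And>j \<psi>. \<psi> \<in> nehari_per \<omega> f (\<kappa>1 j) (\<kappa>2 j) \<Longrightarrow>
      (\<Sum>p\<in>per_cell (\<kappa>1 j) (\<kappa>2 j). G (w j p)) \<le> J_per \<omega> f (\<kappa>1 j) (\<kappa>2 j) \<psi>"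
    and lim: "\<And>p. (\<lambda>j. w j p) \<longlonglongrightarrow> u p"
  shows "ground_state_solution \<omega> f u"
    and "(\<lambda>j. norm_of ell2_inner (\<lambda>p. cut_to_cell (\<kappa>1 j) (\<kappa>2 j) (w j) p - u p)) \<longlonglongrightarrow> 0"
proof -
  interpret E: lattice_functional UNIV ell2 f l \<omega> by (rule lattice_functional_ell2)
  let ?C = "\<lambda>j. per_cell (\<kappa>1 j) (\<kappa>2 j)"
  have in_cell: "eventually (\<lambda>j. B \<subseteq> ?C j) sequentially" if "finite B" for B
    by (rule eventually_subset_per_cell[OF K1 K2 that])
  \<comment> \<open>Fatou through finite sums: every finite set eventually lies in the cell, where
    the bound \<open>R\<close> holds.\<close>
  have u: "u \<in> ell2"
  proof -
    have "(\<Sum>p\<in>B. (u p)\<^sup>2) \<le> R" if "finite B" for B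
    proof (rule tendsto_upperbound)
      show "(\<lambda>j. \<Sum>p\<in>B. (w j p)\<^sup>2) \<longlonglongrightarrow> (\<Sum>p\<in>B. (u p)\<^sup>2)" by (intro tendsto_intros lim)
      show "eventually (\<lambda>j. (\<Sum>p\<in>B. (w j p)\<^sup>2) \<le> R) sequentially"
        using in_cell[OF that]
      proof eventually_elim
        case (elim j)
        then have "(\<Sum>p\<in>B. (w j p)\<^sup>2) \<le> (\<Sum>p\<in>?C j. (w j p)\<^sup>2)" by (intro sum_mono2) auto
        then show ?case using bounded[of j] by linarith
      qed
    qed simp
    then have "bdd_above (sum (\<lambda>p. (u p)\<^sup>2) ` {F. F \<subseteq> UNIV \<and> finite F})" by (auto intro!: bdd_aboveI2)
    then have "(\<lambda>p. (u p)\<^sup>2) summable_on UNIV" by (intro nonneg_bdd_above_summable_on) auto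
    then show ?thesis by (simp add: ell2_def)
  qed
  have solu: "solves_eq \<omega> f u"
    unfolding solves_eq_def
  proof
    fix p
    have "(\<lambda>j. - laplacian (w j) p - \<omega> * w j p) \<longlonglongrightarrow> - laplacian u p - \<omega> * u p"
      unfolding laplacian_shift by (intro tendsto_intros lim)
    moreover have "(\<lambda>j. - laplacian (w j) p - \<omega> * w j p) \<longlonglongrightarrow> f (u p)"
      using tendsto_f[OF lim[of p]] by (simp only: sol[unfolded solves_eq_def, rule_format])
    ultimately show "- laplacian u p - \<omega> * u p = f (u p)" by (rule LIMSEQ_unique)
  qed
  \<comment> \<open>The large site sits at 0 for every \<open>j\<close>, so the pointwise limit
    cannot vanish there.\<close>
  have "\<delta> \<le> \<bar>u 0\<bar>"
    by (rule tendsto_lowerbound[OF tendsto_rabs[OF lim]]) (auto intro!: always_eventually less_imp_le large)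
  then have "u \<noteq> (\<lambda>p. 0)" using \<delta>(1) by auto
  then have neh: "u \<in> nehari_ell2 \<omega> f"
    using u E.solution_identity[OF solu] by (simp add: nehari_ell2_iff ell2_ip_eq)
  have level: "eventually (\<lambda>j. (\<Sum>p\<in>?C j. G (w j p)) \<le> J_ell2 \<omega> f v + \<epsilon>) sequentially"
    if v: "v \<in> nehari_ell2 \<omega> f" and "\<epsilon> > 0" for v \<epsilon>
  proof -
    obtain k0 where k0: "\<And>k1 k2. k0 \<le> k1 \<Longrightarrow> k0 \<le> k2 \<Longrightarrow>
      \<exists>\<psi>\<in>nehari_per \<omega> f k1 k2. J_per \<omega> f k1 k2 \<psi> \<le> J_ell2 \<omega> f v + \<epsilon>"
      using periodic_level_upper_bound[OF \<open>\<omega> < 0\<close> v \<open>\<epsilon> > 0\<close>] by blast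
    have "eventually (\<lambda>j. k0 \<le> \<kappa>1 j) sequentially" "eventually (\<lambda>j. k0 \<le> \<kappa>2 j) sequentially"
      using K1 K2 by (auto simp: filterlim_at_top)
    then show ?thesis
    proof eventually_elim
      case (elim j)
      then show ?case using k0[OF elim] minimal[of _ j] by (meson order_trans)
    qed
  qed
  have J_u: "J_ell2 \<omega> f u = (\<Sum>\<^sub>\<infinity>p. G (u p))" by (rule J_ell2_nehari[OF neh])
  have G_lim: "(\<lambda>j. \<Sum>p\<in>B. G (w j p)) \<longlonglongrightarrow> (\<Sum>p\<in>B. G (u p))" for B
    by (intro tendsto_sum tendsto_G lim)
  have "J_ell2 \<omega> f u \<le> J_ell2 \<omega> f v" if v: "v \<in> nehari_ell2 \<omega> f" for v
  proof (rule field_le_epsilon)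
    fix \<epsilon> :: real assume "\<epsilon> > 0"
    have "(\<Sum>p\<in>B. G (u p)) \<le> J_ell2 \<omega> f v + \<epsilon>" if "finite B" for B
    proof (rule tendsto_upperbound[OF G_lim])
      show "eventually (\<lambda>j. (\<Sum>p\<in>B. G (w j p)) \<le> J_ell2 \<omega> f v + \<epsilon>) sequentially"
        using level[OF v \<open>\<epsilon> > 0\<close>] in_cell[OF that]
      proof eventually_elim
        case (elim j)
        then have "(\<Sum>p\<in>B. G (w j p)) \<le> (\<Sum>p\<in>?C j. G (w j p))"
          by (intro sum_mono2) (auto simp: G_nonneg)
        then show ?case using elim by linarith
      qed
    qed simp
    then show "J_ell2 \<omega> f u \<le> J_ell2 \<omega> f v + \<epsilon>"
      unfolding J_u by (intro infsum_le_finite_sums E.G_summable u) auto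
  qed
  then show "ground_state_solution \<omega> f u"
    using neh solu by (simp add: ground_state_solution_def minimizer_on_def)

  \<comment> \<open>Both \<open>u\<close> and each \<open>w j\<close> have total defect 0. On a
    finite set the defects converge, so off this set the defect of \<open>w j\<close> has almost no
    sum; it controls the mass there once the values are small.\<close>
  let ?D = "\<lambda>u. defect \<omega> f u"
  let ?z = "\<lambda>j p. cut_to_cell (\<kappa>1 j) (\<kappa>2 j) (w j) p - u p"
  obtain \<eta> where \<eta>: "\<eta> > 0" "\<And>t. \<bar>t\<bar> \<ge> \<delta> \<Longrightarrow> \<eta> \<le> G t"
    using G_bounded_below[OF \<delta>(1)] by blast
  have D_u: "infsum (?D u) UNIV = 0"
    using E.infsum_defect[OF u] E.solution_identity[OF solu] by simp
  have "(\<lambda>j. \<Sum>\<^sub>\<infinity>p. (?z j p)\<^sup>2) \<longlonglongrightarrow> 0"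
  proof (rule LIMSEQ_I)
    fix r :: real assume "r > 0"
    define \<iota> where "\<iota> = 1 / (- \<omega>)"
    have \<iota>: "\<iota> > 0" using \<open>\<omega> < 0\<close> by (simp add: \<iota>_def)
    \<comment> \<open>The final estimate is \<open>e + 2 * q + 2 * e\<close> with
      \<open>q = 2 * \<iota> * e\<close>, so this choice makes it exactly \<open>r\<close>.\<close>
    define e where "e = r / (3 + 4 * \<iota>)"
    have den: "3 + 4 * \<iota> > 0" using \<iota> by simp
    have e: "e > 0" using \<open>r > 0\<close> den by (simp add: e_def)
    \<comment> \<open>The mass of \<open>w j\<close> off \<open>B\<close> that a defect of at most
      \<open>e\<close> permits.\<close>
    define q where "q = 2 * \<iota> * e"
    obtain B1 where B1: "finite B1"
      "\<And>C. finite C \<Longrightarrow> B1 \<subseteq> C \<Longrightarrow> \<bar>(\<Sum>\<^sub>\<infinity>p. G (u p)) - (\<Sum>p\<in>C. G (u p))\<bar> < \<eta> / 3"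
      using finite_tail_less[OF E.G_summable[OF u], of "\<eta> / 3"] \<eta>(1) by auto
    obtain B2 where B2: "finite B2"
      "\<And>C. finite C \<Longrightarrow> B2 \<subseteq> C \<Longrightarrow> \<bar>infsum (?D u) UNIV - sum (?D u) C\<bar> < e"
      using finite_tail_less[OF E.defect_summable[OF u] e] by auto
    obtain B3 where B3: "finite B3"
      "\<And>C. finite C \<Longrightarrow> B3 \<subseteq> C \<Longrightarrow> \<bar>(\<Sum>\<^sub>\<infinity>p. (u p)\<^sup>2) - (\<Sum>p\<in>C. (u p)\<^sup>2)\<bar> < e"
      using finite_tail_less[OF ell2.square_summable[OF u] e] by auto
    define B where "B = B1 \<union> B2 \<union> B3"
    have fin: "finite B" using B1 B2 B3 by (simp add: B_def)
    have sub: "B1 \<subseteq> B" "B2 \<subseteq> B" "B3 \<subseteq> B" by (auto simp: B_def)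
    have tG: "(\<Sum>\<^sub>\<infinity>p. G (u p)) - (\<Sum>p\<in>B. G (u p)) < \<eta> / 3"
      using B1(2)[OF fin sub(1)] by linarith
    have tD: "- e < sum (?D u) B"
      using B2(2)[OF fin sub(2)] unfolding D_u by linarith
    have tu: "(\<Sum>\<^sub>\<infinity>p. (u p)\<^sup>2) - (\<Sum>p\<in>B. (u p)\<^sup>2) < e"
      using B3(2)[OF fin sub(3)] by linarith
    have "(\<lambda>j. sum (?D (w j)) B) \<longlonglongrightarrow> sum (?D u) B"
      unfolding defect_def grad_sq_def by (intro tendsto_intros tendsto_f lim)
    then have ev1: "eventually (\<lambda>j. - e < sum (?D (w j)) B) sequentially"
      using tD by (rule order_tendstoD(1))
    have ev2: "eventually (\<lambda>j. (\<Sum>p\<in>B. G (u p)) - \<eta> / 3 < (\<Sum>p\<in>B. G (w j p))) sequentially"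
      using G_lim[of B] \<eta>(1) by (intro order_tendstoD(1)) auto
    have ev3: "eventually (\<lambda>j. (\<Sum>p\<in>?C j. G (w j p)) \<le> J_ell2 \<omega> f u + \<eta> / 3) sequentially"
      using level[OF neh] \<eta>(1) by simp
    have "(\<lambda>j. \<Sum>p\<in>B. (w j p - u p)\<^sup>2) \<longlonglongrightarrow> (\<Sum>p\<in>B. (u p - u p)\<^sup>2)"
      by (intro tendsto_intros lim)
    then have ev4: "eventually (\<lambda>j. (\<Sum>p\<in>B. (w j p - u p)\<^sup>2) < e) sequentially"
      using e by (intro order_tendstoD(2)) auto
    have "eventually (\<lambda>j. norm ((\<Sum>\<^sub>\<infinity>p. (?z j p)\<^sup>2) - 0) < r) sequentially"
      using ev1 ev2 ev3 ev4 in_cell[OF fin]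
    proof eventually_elim
      case (elim j)
      let ?T = "?C j - B"
      have split: "sum h (?C j) = sum h B + sum h ?T" for h :: "int \<times> int \<Rightarrow> real"
        using elim(5) by (metis add.commute finite_per_cell sum.subset_diff)
      \<comment> \<open>Three slacks of \<open>\<eta> / 3\<close>, from the tail of
        \<open>u\<close>, the convergence on \<open>B\<close> and the level bound, leave less than
        \<open>\<eta>\<close> of energy off \<open>B\<close>, while one large site would already
        need \<open>\<eta>\<close>.\<close>
      have small: "\<bar>w j p\<bar> \<le> \<delta>" if "p \<in> ?T" for p
      proof (rule ccontr)
        assume "\<not> \<bar>w j p\<bar> \<le> \<delta>"
        then have "\<eta> \<le> G (w j p)" by (intro \<eta>(2)) simp
        also have "\<dots> \<le> (\<Sum>p\<in>?T. G (w j p))"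
          by (rule member_le_sum[OF that, of "\<lambda>p. G (w j p)"]) (auto simp: G_nonneg)
        finally show False
          using elim(2,3) tG split[of "\<lambda>p. G (w j p)"] \<eta>(1) unfolding J_u by linarith
      qed
      have "- \<omega> / 2 * (\<Sum>p\<in>?T. (w j p)\<^sup>2) \<le> sum (?D (w j)) ?T"
        unfolding sum_distrib_left by (intro sum_mono defect_ge \<delta>(2) small)
      \<comment> \<open>The defect sums to 0 over the cell and exceeds \<open>- e\<close> on
        \<open>B\<close>.\<close>
      also have "\<dots> \<le> e"
        using elim(1) split[of "?D (w j)"] sum_defect_periodic[OF pos per sol] by simp
      finally have T: "(\<Sum>p\<in>?T. (w j p)\<^sup>2) \<le> q"
        using \<open>\<omega> < 0\<close> by (simp add: q_def \<iota>_def field_simps)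
      \<comment> \<open>A majorant in three pieces: the difference itself on \<open>B\<close>, the
        mass of \<open>w j\<close> in the rest of the cell, and the tail of \<open>u\<close> off
        \<open>B\<close>, which also covers the sites outside the cell.\<close>
      let ?g1 = "\<lambda>p. if p \<in> B then (w j p - u p)\<^sup>2 else 0"
      let ?g2 = "\<lambda>p. if p \<in> ?T then 2 * (w j p)\<^sup>2 else 0"
      let ?g3 = "\<lambda>p. if p \<in> B then (u p)\<^sup>2 else 0"
      have finT: "finite ?T" by simp
      note s1 = infsum_restrict_finite[OF fin, of "\<lambda>p. (w j p - u p)\<^sup>2"]
        and s2 = infsum_restrict_finite[OF finT, of "\<lambda>p. 2 * (w j p)\<^sup>2"]
        and s3 = infsum_restrict_finite[OF fin, of "\<lambda>p. (u p)\<^sup>2"]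
      have s4: "(\<lambda>p. 2 * ((u p)\<^sup>2 - ?g3 p)) summable_on UNIV"
        by (intro summable_on_cmult_right summable_on_diff ell2.square_summable u s3)
      have "\<bar>\<Sum>\<^sub>\<infinity>p. (?z j p)\<^sup>2\<bar> \<le> (\<Sum>\<^sub>\<infinity>p. ?g1 p + ?g2 p + 2 * ((u p)\<^sup>2 - ?g3 p))"
      proof (rule abs_infsum_le)
        show "(\<lambda>p. ?g1 p + ?g2 p + 2 * ((u p)\<^sup>2 - ?g3 p)) summable_on UNIV"
          by (intro summable_on_add s1 s2 s4)
        have sq: "(x - y)\<^sup>2 \<le> 2 * x\<^sup>2 + 2 * y\<^sup>2" for x y :: real
          using zero_le_power2[of "x + y"] by (simp add: power2_eq_square algebra_simps)
        show "\<bar>(?z j p)\<^sup>2\<bar> \<le> ?g1 p + ?g2 p + 2 * ((u p)\<^sup>2 - ?g3 p)" for p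
          using sq[of "w j p" "u p"] elim(5) by (cases "p \<in> B"; cases "p \<in> ?C j") (auto simp: cut_to_cell_def)
      qed
      also have "\<dots> = (\<Sum>p\<in>B. (w j p - u p)\<^sup>2) + 2 * (\<Sum>p\<in>?T. (w j p)\<^sup>2) +
          2 * ((\<Sum>\<^sub>\<infinity>p. (u p)\<^sup>2) - (\<Sum>p\<in>B. (u p)\<^sup>2))"
        by (simp only: infsum_add[OF summable_on_add[OF s1(1) s2(1)] s4] infsum_add[OF s1(1) s2(1)]
            infsum_cmult_right' infsum_diff[OF ell2.square_summable[OF u] s3(1)] s1(2) s2(2) s3(2)
            sum_distrib_left)
      also have "\<dots> < e + 2 * q + 2 * e"
        using elim(4) T tu by (intro add_less_le_mono mult_left_mono) auto
      also have "\<dots> = e * (3 + 4 * \<iota>)" by (simp add: q_def algebra_simps)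
      also have "\<dots> = r" using den by (simp add: e_def)
      finally show ?case by simp
    qed
    then show "\<exists>N. \<forall>j\<ge>N. norm ((\<Sum>\<^sub>\<infinity>p. (?z j p)\<^sup>2) - 0) < r"
      by (simp add: eventually_sequentially)
  qed
  from tendsto_real_sqrt[OF this]
  show "(\<lambda>j. norm_of ell2_inner (?z j)) \<longlonglongrightarrow> 0"
    by (simp add: norm_of_def ell2_inner_def power2_eq_square)
qed

lemma nehari_per_empty:
  assumes "\<omega> > 8" "k1 > 0" "k2 > 0" "u \<in> nehari_per \<omega> f k1 k2"
  shows False
proof -
  interpret P: lattice_functional "per_cell k1 k2" "per_space k1 k2" f l \<omega>
    by (rule lattice_functional_per[OF assms(2,3)])
  have u: "u \<in> per_space k1 k2" "u \<noteq> (\<lambda>p. 0)"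
    "P.ip (L_op \<omega> u) u = (\<Sum>p\<in>per_cell k1 k2. f (u p) * u p)"
    using assms(4) by (auto simp: nehari_per_iff[OF assms(2,3)] P.ip_def per_inner_def)
  obtain q where q: "q \<in> per_cell k1 k2" "u q \<noteq> 0"
    using per_space_nonzero_in_cell[OF assms(2,3) u(1,2)] .
  have "0 < f (u q) * u q" by (rule f_mult_pos[OF q(2)])
  also have "\<dots> \<le> (\<Sum>p\<in>per_cell k1 k2. f (u p) * u p)"
    by (rule member_le_sum[OF q(1), of "\<lambda>p. f (u p) * u p"]) (auto simp: f_mult_nonneg)
  also have "\<dots> \<le> (8 - \<omega>) * P.ip u u" using P.ip_L_op_le[OF u(1), of \<omega>] u(3) by simp
  also have "\<dots> \<le> 0" using assms(1) P.ip_self_nonneg[of u] by (intro mult_nonpos_nonneg) auto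
  finally show False by simp
qed

lemma convergence_to_ground_states:
  assumes "\<omega> < 0" and "4 - \<omega> < l"
    and U: "\<And>k1 k2. k1 > 1 \<Longrightarrow> k2 > 1 \<Longrightarrow> per_ground_state_solution \<omega> f k1 k2 (U k1 k2)"
  shows "\<exists>b c. converges_to_ground_states \<omega> f U b c"
proof -
  obtain \<delta> where \<delta>: "\<delta> > 0" "\<And>t. \<bar>t\<bar> \<le> \<delta> \<Longrightarrow> f t * t \<le> - \<omega> / 2 * t\<^sup>2"
    using f_mult_small[of "- \<omega>"] \<open>\<omega> < 0\<close> by auto
  have U_neh: "U k1 k2 \<in> nehari_per \<omega> f k1 k2" and U_sol: "solves_eq \<omega> f (U k1 k2)"
    and U_min: "\<And>\<psi>. \<psi> \<in> nehari_per \<omega> f k1 k2 \<Longrightarrow>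
       (\<Sum>p\<in>per_cell k1 k2. G (U k1 k2 p)) \<le> J_per \<omega> f k1 k2 \<psi>"
    and U_per: "U k1 k2 \<in> per_space k1 k2" and U_nz: "U k1 k2 \<noteq> (\<lambda>p. 0)"
    if "k1 > 1" "k2 > 1" for k1 k2
  proof -
    have pos: "k1 > 0" "k2 > 0" using that by auto
    show neh: "U k1 k2 \<in> nehari_per \<omega> f k1 k2" and "solves_eq \<omega> f (U k1 k2)"
      using U[OF that] by (auto simp: per_ground_state_solution_def minimizer_on_def)
    show "U k1 k2 \<in> per_space k1 k2" "U k1 k2 \<noteq> (\<lambda>p. 0)"
      using neh by (simp_all add: nehari_per_iff[OF pos])
    show "(\<Sum>p\<in>per_cell k1 k2. G (U k1 k2 p)) \<le> J_per \<omega> f k1 k2 \<psi>"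
      if "\<psi> \<in> nehari_per \<omega> f k1 k2" for \<psi>
      using U[OF \<open>k1 > 1\<close> \<open>k2 > 1\<close>] that
      by (simp add: per_ground_state_solution_def minimizer_on_def flip: J_per_nehari[OF pos neh])
  qed
  have "\<exists>p. \<delta> < \<bar>U k1 k2 p\<bar>" if k: "k1 > 1" "k2 > 1" for k1 k2
    by (rule periodic_solution_large_site[OF \<open>\<omega> < 0\<close> \<delta>(2) _ _ U_per[OF k] U_nz[OF k] U_sol[OF k]])
      (use k in auto)
  \<comment> \<open>One site per pair of periods, chosen before any sequence of periods is given, as
    a translation fixed for the whole family requires.\<close>
  then obtain s where s: "\<And>k1 k2. k1 > 1 \<Longrightarrow> k2 > 1 \<Longrightarrow> \<delta> < \<bar>U k1 k2 (s k1 k2)\<bar>"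
    by metis
  define b where "b k1 k2 = fst (s k1 k2)" for k1 k2
  define c where "c k1 k2 = snd (s k1 k2)" for k1 k2
  obtain E k0 where E: "\<And>k1 k2. k0 \<le> k1 \<Longrightarrow> k0 \<le> k2 \<Longrightarrow>
      \<exists>\<psi>\<in>nehari_per \<omega> f k1 k2. J_per \<omega> f k1 k2 \<psi> \<le> E"
    using periodic_level_bounded[OF assms(1,2)] by blast
  obtain R where R: "\<And>k1 k2 u. k1 > 0 \<Longrightarrow> k2 > 0 \<Longrightarrow> u \<in> per_space k1 k2 \<Longrightarrow> solves_eq \<omega> f u \<Longrightarrow>
    (\<Sum>p\<in>per_cell k1 k2. G (u p)) \<le> E \<Longrightarrow> (\<Sum>p\<in>per_cell k1 k2. (u p)\<^sup>2) \<le> R"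
    using periodic_solution_bounded[OF \<open>\<omega> < 0\<close>] by blast
  have "converges_to_ground_states \<omega> f U b c"
    unfolding converges_to_ground_states_def
  proof (intro allI impI)
    fix K1 K2 :: "nat \<Rightarrow> int"
    assume K: "filterlim K1 at_top sequentially" "filterlim K2 at_top sequentially"
    have "eventually (\<lambda>j. max 2 k0 \<le> K1 j) sequentially" "eventually (\<lambda>j. max 2 k0 \<le> K2 j) sequentially"
      using K by (auto simp: filterlim_at_top simp del: max.bounded_iff)
    then have "eventually (\<lambda>j. max 2 k0 \<le> K1 j \<and> max 2 k0 \<le> K2 j) sequentially"
      by (rule eventually_conj)
    then obtain N where N: "\<And>j. j \<ge> N \<Longrightarrow> max 2 k0 \<le> K1 j \<and> max 2 k0 \<le> K2 j"
      unfolding eventually_sequentially by blast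
    \<comment> \<open>Finitely many terms are dropped so that every pair of periods is admissible
      and the energy bound \<open>E\<close> holds for all \<open>j\<close>.\<close>
    define k1 k2 where k_def: "k1 j = K1 (j + N)" "k2 j = K2 (j + N)" for j
    have k: "k1 j > 1" "k2 j > 1" "k0 \<le> k1 j" "k0 \<le> k2 j" for j
      using N[of "j + N"] by (auto simp: k_def)
    have kpos: "k1 j > 0" "k2 j > 0" for j using k(1,2)[of j] by auto
    define w where "w j = translate (b (k1 j) (k2 j)) (c (k1 j) (k2 j)) (U (k1 j) (k2 j))" for j
    have w_per: "w j \<in> per_space (k1 j) (k2 j)" for j
      unfolding w_def by (intro translate_per_space U_per k)
    have w_sol: "solves_eq \<omega> f (w j)" for j
      unfolding w_def by (intro solves_eq_translate U_sol k)
    have w_large: "\<delta> < \<bar>w j 0\<bar>" for j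
      using s[OF k(1,2)[of j]] by (simp add: w_def translate_eq b_def c_def)
    \<comment> \<open>The translation moves sites across the cell boundary; by periodicity the sum
      over the cell does not change.\<close>
    have w_energy: "(\<Sum>p\<in>per_cell (k1 j) (k2 j). G (w j p)) =
        (\<Sum>p\<in>per_cell (k1 j) (k2 j). G (U (k1 j) (k2 j) p))" for j
      unfolding w_def translate_eq
      using sum_per_cell_shift[of "\<lambda>p. G (U (k1 j) (k2 j) p)" "k1 j" "k2 j"] U_per[OF k(1,2)[of j]] kpos[of j]
      by (simp add: per_space_def)
    have w_min: "(\<Sum>p\<in>per_cell (k1 j) (k2 j). G (w j p)) \<le> J_per \<omega> f (k1 j) (k2 j) \<psi>"
      if "\<psi> \<in> nehari_per \<omega> f (k1 j) (k2 j)" for j \<psi>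
      unfolding w_energy by (rule U_min[OF k(1,2) that])
    have w_E: "(\<Sum>p\<in>per_cell (k1 j) (k2 j). G (w j p)) \<le> E" for j
      using E[OF k(3,4)[of j]] w_min by (meson order_trans)
    have w_R: "(\<Sum>p\<in>per_cell (k1 j) (k2 j). (w j p)\<^sup>2) \<le> R" for j
      by (rule R[OF kpos w_per w_sol w_E])
    obtain r u where r: "strict_mono r" "\<And>p. (\<lambda>j. w (r j) p) \<longlonglongrightarrow> u p"
      using pointwise_convergent_subsequence[of w "sqrt R"]
        per_space_pointwise_le[OF kpos w_per w_R] by blast
    have lims: "filterlim (\<lambda>j. k1 (r j)) at_top sequentially" "filterlim (\<lambda>j. k2 (r j)) at_top sequentially"
    proof -
      have "filterlim (\<lambda>j. r j + N) at_top sequentially"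
        using filterlim_subseq[OF r(1)] by (intro filterlim_at_top_mono[where f = r and g = "\<lambda>j. r j + N"]) auto
      then show "filterlim (\<lambda>j. k1 (r j)) at_top sequentially" "filterlim (\<lambda>j. k2 (r j)) at_top sequentially"
        unfolding k_def using K by (auto intro: filterlim_compose)
    qed
    note limit = ground_state_limit[of \<omega> \<delta> "\<lambda>j. k1 (r j)" "\<lambda>j. k2 (r j)" "\<lambda>j. w (r j)" R u,
        OF \<open>\<omega> < 0\<close> \<delta> lims kpos w_per w_sol w_large w_R w_min r(2)]
    \<comment> \<open>Undoes the index shift by \<open>N\<close>, giving a subsequence of the
      original periods.\<close>
    have "strict_mono (\<lambda>j. r j + N)"
      using r(1) by (simp add: strict_mono_def)
    then show "\<exists>u r. ground_state_solution \<omega> f u \<and> strict_mono (r :: nat \<Rightarrow> nat) \<and>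
           (\<lambda>j. norm_of ell2_inner (\<lambda>p.
                  cut_to_cell (K1 (r j)) (K2 (r j))
                    (translate (b (K1 (r j)) (K2 (r j))) (c (K1 (r j)) (K2 (r j)))
                      (U (K1 (r j)) (K2 (r j)))) p - u p)) \<longlonglongrightarrow> 0"
      using limit unfolding w_def k_def by blast
  qed
  then show ?thesis by blast
qed

end

theorem theorem3p3:
  fixes \<omega> l :: real and f :: "real \<Rightarrow> real" and U :: "int \<Rightarrow> int \<Rightarrow> lattice_fun"
  assumes "h1 f" and "h2 f l" and "h3 f" and "h4 f"
    and "0 \<notin> ell2_spectrum (L_op \<omega>)" and "l \<notin> ell2_spectrum (L_op \<omega>)"
    and "\<omega> < 0 \<Longrightarrow> l > - \<omega>"
    and "\<And>k1 k2. k1 > 1 \<Longrightarrow> k2 > 1 \<Longrightarrow> per_ground_state_solution \<omega> f k1 k2 (U k1 k2)"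
  shows "\<exists>b c. converges_to_ground_states \<omega> f U b c"
proof -
  interpret nonlinearity f l by unfold_locales (rule assms)+
  have "\<omega> < 0 \<or> \<omega> > 8"
    using ell2_spectrum_L_op[of \<omega> 0] assms(5) by force
  \<comment> \<open>For \<open>\<omega> > 8\<close> the Nehari sets are empty, contradicting the
    ground state given for the periods 2 and 2.\<close>
  moreover have "\<not> \<omega> > 8"
    using nehari_per_empty[of \<omega> 2 2 "U 2 2"] assms(8)[of 2 2]
    by (auto simp: per_ground_state_solution_def minimizer_on_def)
  ultimately have "\<omega> < 0" by blast
  \<comment> \<open>\<open>l\<close> lies above \<open>- \<omega>\<close> and outside the spectral
    band, hence above \<open>8 - \<omega>\<close>.\<close>
  moreover have "4 - \<omega> < l"
    using ell2_spectrum_L_op[of \<omega> l] assms(6) assms(7)[OF \<open>\<omega> < 0\<close>] by force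
  ultimately show ?thesis
    using assms(8) by (rule convergence_to_ground_states)
qed

end
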